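(* $\mathsf{CatBaseComp}$ is a $(2\text{-}\mathrm{fam},\Sigma)$-category in the following way: for $P,S\in\mathrm{fHom}(\mathscr C,C)$ the 2-family arrows from $P$ to $S$ are the natural transformations $\eta\colon P\Rightarrow S$; the horizontal composition $\eta\bullet F$ is the horizontal composition of a natural transformation and a functor; and the arrows $$\sum_{P,S}\eta\colon\sum_{(\mathscr C,C)}P\to\sum_{(\mathscr C,C)}S$$ send $(c,y)$ to $(c,\eta_c(y))$.
   Context: A base of computability $B$ in a category $\mathscr C$ is a family $(B(a))_{a\in\mathscr C_0}$, where each $B(a)$ is a subclass of the class $\mathrm{Mon}(-,a)$ of monomorphisms with codomain $a$, such that: (Base1) $1_a\in B(a)$ for every object $a$; (Base2) for all objects $a,b$, all $i\colon s\to a$ in $B(a)$, all $j\colon t\to b$ in $B(b)$, and all $f\colon s\to b$, there is a pullback of $j$ along $f$, with projection $f^*j\colon j^*(s)\to s$, such that $i\circ f^*j\in B(a)$. If $C$, $D$ are bases of computability in $\mathscr C$, $\mathscr D$, a computability transfer $F\colon(\mathscr C,C)\to(\mathscr D,D)$ is a functor $F\colon\mathscr C\to\mathscr D$ such that $F(i)\in D(F(a))$ for all objects $a$ and all $i\in C(a)$, and $F$ preserves all pullbacks occurring in (Base2) (i.e. pullbacks of arrows $j\in C(b)$ along arbitrary arrows $f\colon s\to b$). $\mathsf{CatBaseComp}$ is the category of categories with a base of computability and computability transfers. A fam-category is a category $\mathscr K$ with a collection $\mathrm{fHom}(c)$ of family arrows for each object $c$, and composition operations $\mathrm{fHom}(d)\times\mathrm{Hom}(c,d)\to\mathrm{fHom}(c)$,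 $(\lambda,f)\mapsto\lambda\circ f$, such that $\lambda\circ1_c=\lambda$ and $\lambda\circ(g\circ f)=(\lambda\circ g)\circ f$. A $(\mathrm{fam},\Sigma)$-structure on a fam-category consists of objects $\sum_a\lambda$ and arrows $\mathrm{pr}_1^{a,\lambda}\colon\sum_a\lambda\to a$, $\Sigma_\lambda f\colon\sum_b(\lambda\circ f)\to\sum_a\lambda$ (for $\lambda\in\mathrm{fHom}(a)$, $f\colon b\to a$) such that the square with top $\Sigma_\lambda f$, left side $\mathrm{pr}_1^{b,\lambda\circ f}$, right side $\mathrm{pr}_1^{a,\lambda}$ and bottom $f$ is a pullback, $\Sigma_\lambda1_a=1_{\sum_a\lambda}$ and $\Sigma_\lambda(f\circ g)=(\Sigma_\lambda f)\circ\Sigma_{\lambda\circ f}g$. A 2-fam-category is a fam-category in which every $\mathrm{fHom}(c)$ is a category (its morphisms are called 2-family arrows), with operations assigning to $\eta\in\mathrm{Hom}(\lambda,\mu)$ (where $\lambda,\mu\in\mathrm{fHom}(c')$) and $f\colon c\to c'$ a 2-family arrow $\eta\bullet f\in\mathrm{Hom}(\lambda\circ f,\mu\circ f)$ such that $\eta\bullet1_c=\eta$, $\eta\bullet(g\circ f)=(\eta\bullet g)\bullet f$ (compatibility), and $(\eta'\circ\eta)\bullet f=(\eta'\bullet f)\circ(\eta\bullet f)$ (distributivity). A $(2\text{-}\mathrm{fam},\Sigma)$-category is a 2-fam-category whose underlying fam-category has a $(\mathrm{fam},\Sigma)$-structure, together with, for every object $c$, $\lambda,\mu\in\mathrm{fHom}(c)$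 and $\eta\in\mathrm{Hom}(\lambda,\mu)$, an arrow $\sum_{\lambda,\mu}\eta\colon\sum_c\lambda\to\sum_c\mu$ such that: $\mathrm{pr}_1^{c,\mu}\circ\sum_{\lambda,\mu}\eta=\mathrm{pr}_1^{c,\lambda}$; for every $f\colon c\to c'$ and $\eta\in\mathrm{Hom}(\lambda,\mu)$ with $\lambda,\mu\in\mathrm{fHom}(c')$, $\big(\sum_{\lambda,\mu}\eta\big)\circ\Sigma_\lambda f=\Sigma_\mu f\circ\sum_{\lambda\circ f,\mu\circ f}(\eta\bullet f)$; $\sum_{\lambda,\lambda}1_\lambda=1_{\sum_c\lambda}$; and $\sum_{\lambda,\mu}\eta\circ\sum_{\nu,\lambda}\eta'=\sum_{\nu,\mu}(\eta\circ\eta')$. The $(\mathrm{fam},\Sigma)$-structure on $\mathsf{CatBaseComp}$: $\mathrm{fHom}(\mathscr C,C)$ is the collection of all functors $P\colon\mathscr C^{\mathrm{op}}\to\mathsf{Sets}$, composed with computability transfers as functors; $\sum_{(\mathscr C,C)}P=\big(\sum_{\mathscr C}P,(\mathrm{pr}_1^P)^{-1}(C)\big)$, where $\sum_{\mathscr C}P$ is the category of elements of $P$ (objects $(c,x)$ with $x\in P(c)$) with projection $\mathrm{pr}_1^P$ to $\mathscr C$, and $(\mathrm{pr}_1^P)^{-1}(C)(c,x)$ is the class of monos with codomain $(c,x)$ that are $\mathrm{pr}_1^P$-cartesian lifts of some $j\in C(c)$; $\Sigma_PF$ is the functor $(d,x)\mapsto(F(d),x)$. On arrows, $\sum_{P,S}\eta$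 acts as identity on the underlying arrow of $\mathscr C$. *)

theory Defs
  imports Main "HOL-Library.FuncSet"
begin

section \<open>Categories, functors, natural transformations\<close>

record ('o, 'a) cat =
  Obj :: "'o set"
  Mor :: "'a set"
  Src :: "'a \<Rightarrow> 'o"
  Tgt :: "'a \<Rightarrow> 'o"
  Idn :: "'o \<Rightarrow> 'a"
  Cmp :: "'a \<Rightarrow> 'a \<Rightarrow> 'a"  \<comment> \<open>\<open>Cmp C g f\<close> is g after f\<close>

definition Hom :: "('o, 'a) cat \<Rightarrow> 'o \<Rightarrow> 'o \<Rightarrow> 'a set" where
  "Hom C a b = {f \<in> Mor C. Src C f = a \<and> Tgt C f = b}"

locale category =
  fixes C :: "('o, 'a) cat"
  assumes Src_Obj: "f \<in> Mor C \<Longrightarrow> Src C f \<in> Obj C"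
    and Tgt_Obj: "f \<in> Mor C \<Longrightarrow> Tgt C f \<in> Obj C"
    and Idn_Hom: "a \<in> Obj C \<Longrightarrow> Idn C a \<in> Hom C a a"
    and Cmp_Hom: "f \<in> Hom C a b \<Longrightarrow> g \<in> Hom C b c \<Longrightarrow> Cmp C g f \<in> Hom C a c"
    and Idn_right: "f \<in> Hom C a b \<Longrightarrow> Cmp C f (Idn C a) = f"
    and Idn_left: "f \<in> Hom C a b \<Longrightarrow> Cmp C (Idn C b) f = f"
    and Cmp_assoc: "f \<in> Hom C a b \<Longrightarrow> g \<in> Hom C b c \<Longrightarrow> h \<in> Hom C c d \<Longrightarrow>
      Cmp C h (Cmp C g f) = Cmp C (Cmp C h g) f"

text \<open>HOL functions are total. This normalisation of the operations outside their domains makes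
  equality of records coincide with equality of categories; it is imposed on the categories that
  are themselves objects of \<open>CatBaseComp\<close>.\<close>

definition extensional_cat :: "('o, 'a) cat \<Rightarrow> bool" where
  "extensional_cat C \<longleftrightarrow>
     Src C \<in> extensional (Mor C) \<and> Tgt C \<in> extensional (Mor C) \<and>
     Idn C \<in> extensional (Obj C) \<and>
     (\<forall>g f. \<not> (f \<in> Mor C \<and> g \<in> Mor C \<and> Tgt C f = Src C g) \<longrightarrow> Cmp C g f = undefined)"

definition op_cat :: "('o, 'a) cat \<Rightarrow> ('o, 'a) cat" where
  "op_cat C = \<lparr>Obj = Obj C, Mor = Mor C, Src = Tgt C, Tgt = Src C, Idn = Idn C,
               Cmp = (\<lambda>g f. Cmp C f g)\<rparr>"

definition mono_arrow :: "('o, 'a) cat \<Rightarrow> 'a \<Rightarrow> bool" where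
  "mono_arrow C i \<longleftrightarrow> i \<in> Mor C \<and>
     (\<forall>z. \<forall>h \<in> Hom C z (Src C i). \<forall>k \<in> Hom C z (Src C i). Cmp C i h = Cmp C i k \<longrightarrow> h = k)"

text \<open>The square with \<open>f \<circ> p = g \<circ> q\<close>; \<open>p\<close> is the pullback of \<open>g\<close> along \<open>f\<close>.\<close>

definition is_pullback :: "('o, 'a) cat \<Rightarrow> 'a \<Rightarrow> 'a \<Rightarrow> 'a \<Rightarrow> 'a \<Rightarrow> bool" where
  "is_pullback C p q f g \<longleftrightarrow>
     p \<in> Mor C \<and> q \<in> Mor C \<and> f \<in> Mor C \<and> g \<in> Mor C \<and>
     Src C p = Src C q \<and> Tgt C p = Src C f \<and> Tgt C q = Src C g \<and> Tgt C f = Tgt C g \<and>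
     Cmp C f p = Cmp C g q \<and>
     (\<forall>z \<in> Obj C. \<forall>h \<in> Hom C z (Src C f). \<forall>k \<in> Hom C z (Src C g).
        Cmp C f h = Cmp C g k \<longrightarrow>
        (\<exists>!u. u \<in> Hom C z (Src C p) \<and> Cmp C p u = h \<and> Cmp C q u = k))"

record ('o, 'a, 'p, 'b) func =
  Fob :: "'o \<Rightarrow> 'p"
  Far :: "'a \<Rightarrow> 'b"

definition is_functor :: "('o, 'a) cat \<Rightarrow> ('p, 'b) cat \<Rightarrow> ('o, 'a, 'p, 'b) func \<Rightarrow> bool" where
  "is_functor C D F \<longleftrightarrow>
     Fob F \<in> Obj C \<rightarrow>\<^sub>E Obj D \<and> Far F \<in> Mor C \<rightarrow>\<^sub>E Mor D \<and>
     (\<forall>a b. \<forall>f \<in> Hom C a b. Far F f \<in> Hom D (Fob F a) (Fob F b)) \<and>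
     (\<forall>a \<in> Obj C. Far F (Idn C a) = Idn D (Fob F a)) \<and>
     (\<forall>a b c. \<forall>f \<in> Hom C a b. \<forall>g \<in> Hom C b c.
        Far F (Cmp C g f) = Cmp D (Far F g) (Far F f))"

definition id_func :: "('o, 'a) cat \<Rightarrow> ('o, 'a, 'o, 'a) func" where
  "id_func C = \<lparr>Fob = (\<lambda>a\<in>Obj C. a), Far = (\<lambda>f\<in>Mor C. f)\<rparr>"

text \<open>\<open>comp_func C G F\<close> is G after F, where \<open>C\<close> is the source of \<open>F\<close>.\<close>

definition comp_func ::
  "('o, 'a) cat \<Rightarrow> ('p, 'b, 'q, 'c) func \<Rightarrow> ('o, 'a, 'p, 'b) func \<Rightarrow> ('o, 'a, 'q, 'c) func" where
  "comp_func C G F =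
     \<lparr>Fob = compose (Obj C) (Fob G) (Fob F), Far = compose (Mor C) (Far G) (Far F)\<rparr>"

definition nat_trans :: "('o, 'a) cat \<Rightarrow> ('p, 'b) cat \<Rightarrow> ('o, 'a, 'p, 'b) func \<Rightarrow>
    ('o, 'a, 'p, 'b) func \<Rightarrow> ('o \<Rightarrow> 'b) \<Rightarrow> bool" where
  "nat_trans C D F G \<eta> \<longleftrightarrow>
     \<eta> \<in> extensional (Obj C) \<and>
     (\<forall>a \<in> Obj C. \<eta> a \<in> Hom D (Fob F a) (Fob G a)) \<and>
     (\<forall>a b. \<forall>f \<in> Hom C a b. Cmp D (\<eta> b) (Far F f) = Cmp D (Far G f) (\<eta> a))"

datatype ('x, 'm) arr = Arr (asrc: 'x) (amap: 'm) (atgt: 'x)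

definition functor_cat :: "('o, 'a) cat \<Rightarrow> ('p, 'b) cat \<Rightarrow>
    (('o, 'a, 'p, 'b) func, (('o, 'a, 'p, 'b) func, 'o \<Rightarrow> 'b) arr) cat" where
  "functor_cat C D =
     \<lparr>Obj = {F. is_functor C D F},
      Mor = {Arr F \<eta> G | F \<eta> G. is_functor C D F \<and> is_functor C D G \<and> nat_trans C D F G \<eta>},
      Src = asrc, Tgt = atgt,
      Idn = (\<lambda>F. Arr F (\<lambda>a\<in>Obj C. Idn D (Fob F a)) F),
      Cmp = (\<lambda>\<theta> \<eta>. Arr (asrc \<eta>) (\<lambda>a\<in>Obj C. Cmp D (amap \<theta> a) (amap \<eta> a)) (atgt \<theta>))\<rparr>"

text \<open>The category of all sets with elements in the type \<open>'u\<close>.\<close>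

definition Sets :: "('u set, ('u set, 'u \<Rightarrow> 'u) arr) cat" where
  "Sets =
     \<lparr>Obj = UNIV,
      Mor = {Arr A f B | A f B. f \<in> A \<rightarrow>\<^sub>E B},
      Src = asrc, Tgt = atgt,
      Idn = (\<lambda>A. Arr A (\<lambda>x\<in>A. x) A),
      Cmp = (\<lambda>g f. Arr (asrc f) (compose (asrc f) (amap g) (amap f)) (atgt g))\<rparr>"

text \<open>\<open>u\<close> is cartesian with respect to the functor \<open>p\<close> from \<open>E\<close> to \<open>C\<close>.\<close>

definition cartesian_arrow ::
  "('o, 'a) cat \<Rightarrow> ('p, 'b) cat \<Rightarrow> ('o, 'a, 'p, 'b) func \<Rightarrow> 'a \<Rightarrow> bool" where
  "cartesian_arrow E C p u \<longleftrightarrow> u \<in> Mor E \<and>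
     (\<forall>z \<in> Obj E. \<forall>v \<in> Hom E z (Tgt E u). \<forall>h \<in> Hom C (Fob p z) (Fob p (Src E u)).
        Cmp C (Far p u) h = Far p v \<longrightarrow>
        (\<exists>!w. w \<in> Hom E z (Src E u) \<and> Far p w = h \<and> Cmp E u w = v))"


section \<open>Bases of computability\<close>

definition base_of_computability :: "('o, 'a) cat \<Rightarrow> ('o \<Rightarrow> 'a set) \<Rightarrow> bool" where
  "base_of_computability C B \<longleftrightarrow>
     B \<in> extensional (Obj C) \<and>
     (\<forall>a \<in> Obj C. \<forall>i \<in> B a. mono_arrow C i \<and> Tgt C i = a) \<and>
     (\<forall>a \<in> Obj C. Idn C a \<in> B a) \<and>
     (\<forall>a \<in> Obj C. \<forall>b \<in> Obj C. \<forall>i \<in> B a. \<forall>j \<in> B b. \<forall>f \<in> Hom C (Src C i) b.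
        \<exists>p q. is_pullback C p q f j \<and> Cmp C i p \<in> B a)"

definition computability_transfer :: "('o, 'a) cat \<Rightarrow> ('o \<Rightarrow> 'a set) \<Rightarrow>
    ('p, 'b) cat \<Rightarrow> ('p \<Rightarrow> 'b set) \<Rightarrow> ('o, 'a, 'p, 'b) func \<Rightarrow> bool" where
  "computability_transfer C B D B' F \<longleftrightarrow>
     is_functor C D F \<and>
     (\<forall>a \<in> Obj C. \<forall>i \<in> B a. Far F i \<in> B' (Fob F a)) \<and>
     (\<forall>b \<in> Obj C. \<forall>j \<in> B b. \<forall>f p q. is_pullback C p q f j \<longrightarrow>
        is_pullback D (Far F p) (Far F q) (Far F f) (Far F j))"


section \<open>Fam-categories and their two-dimensional version\<close>

locale fam_category = category K
  for K :: "('o, 'a) cat" +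
  fixes fHom :: "'o \<Rightarrow> 'l set"
    and fcomp :: "'l \<Rightarrow> 'a \<Rightarrow> 'l"
  assumes fcomp_fHom: "f \<in> Hom K c d \<Longrightarrow> \<kappa> \<in> fHom d \<Longrightarrow> fcomp \<kappa> f \<in> fHom c"
    and fcomp_Idn: "c \<in> Obj K \<Longrightarrow> \<kappa> \<in> fHom c \<Longrightarrow> fcomp \<kappa> (Idn K c) = \<kappa>"
    and fcomp_Cmp: "f \<in> Hom K b c \<Longrightarrow> g \<in> Hom K c d \<Longrightarrow> \<kappa> \<in> fHom d \<Longrightarrow>
      fcomp \<kappa> (Cmp K g f) = fcomp (fcomp \<kappa> g) f"

text \<open>\<open>FSum a \<kappa>\<close>, \<open>pr a \<kappa>\<close> and \<open>Sig \<kappa> f\<close> are the sum of the family arrow \<open>\<kappa>\<close> over \<open>a\<close>, its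
  first projection, and the arrow over \<open>f\<close> (whose codomain \<open>a\<close> is recorded in \<open>f\<close>).\<close>

locale fam_Sigma_category = fam_category K fHom fcomp
  for K :: "('o, 'a) cat" and fHom :: "'o \<Rightarrow> 'l set" and fcomp :: "'l \<Rightarrow> 'a \<Rightarrow> 'l" +
  fixes FSum :: "'o \<Rightarrow> 'l \<Rightarrow> 'o"
    and pr :: "'o \<Rightarrow> 'l \<Rightarrow> 'a"
    and Sig :: "'l \<Rightarrow> 'a \<Rightarrow> 'a"
  assumes Sum_Obj: "a \<in> Obj K \<Longrightarrow> \<kappa> \<in> fHom a \<Longrightarrow> FSum a \<kappa> \<in> Obj K"
    and pr_Hom: "a \<in> Obj K \<Longrightarrow> \<kappa> \<in> fHom a \<Longrightarrow> pr a \<kappa> \<in> Hom K (FSum a \<kappa>) a"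
    and Sig_Hom: "f \<in> Hom K b a \<Longrightarrow> \<kappa> \<in> fHom a \<Longrightarrow>
      Sig \<kappa> f \<in> Hom K (FSum b (fcomp \<kappa> f)) (FSum a \<kappa>)"
    and Sig_pullback: "f \<in> Hom K b a \<Longrightarrow> \<kappa> \<in> fHom a \<Longrightarrow>
      is_pullback K (pr b (fcomp \<kappa> f)) (Sig \<kappa> f) f (pr a \<kappa>)"
    and Sig_Idn: "a \<in> Obj K \<Longrightarrow> \<kappa> \<in> fHom a \<Longrightarrow> Sig \<kappa> (Idn K a) = Idn K (FSum a \<kappa>)"
    and Sig_Cmp: "g \<in> Hom K c b \<Longrightarrow> f \<in> Hom K b a \<Longrightarrow> \<kappa> \<in> fHom a \<Longrightarrow>
      Sig \<kappa> (Cmp K f g) = Cmp K (Sig \<kappa> f) (Sig (fcomp \<kappa> f) g)"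

text \<open>\<open>fCat c\<close> is the category of family arrows and 2-family arrows over \<open>c\<close>.\<close>

locale two_fam_category = fam_category K "\<lambda>c. Obj (fCat c)" fcomp
  for K :: "('o, 'a) cat" and fCat :: "'o \<Rightarrow> ('l, 'm) cat" and fcomp :: "'l \<Rightarrow> 'a \<Rightarrow> 'l" +
  fixes whisker :: "'m \<Rightarrow> 'a \<Rightarrow> 'm"
  assumes fCat_category: "c \<in> Obj K \<Longrightarrow> category (fCat c)"
    and whisker_Hom: "f \<in> Hom K c c' \<Longrightarrow> \<eta> \<in> Hom (fCat c') \<kappa> \<mu> \<Longrightarrow>
      whisker \<eta> f \<in> Hom (fCat c) (fcomp \<kappa> f) (fcomp \<mu> f)"
    and whisker_Idn: "c \<in> Obj K \<Longrightarrow> \<eta> \<in> Hom (fCat c) \<kappa> \<mu> \<Longrightarrow> whisker \<eta> (Idn K c) = \<eta>"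
    and whisker_Cmp: "f \<in> Hom K c c' \<Longrightarrow> g \<in> Hom K c' c'' \<Longrightarrow> \<eta> \<in> Hom (fCat c'') \<kappa> \<mu> \<Longrightarrow>
      whisker \<eta> (Cmp K g f) = whisker (whisker \<eta> g) f"
    and whisker_distrib: "f \<in> Hom K c c' \<Longrightarrow> \<eta> \<in> Hom (fCat c') \<kappa> \<mu> \<Longrightarrow>
      \<eta>' \<in> Hom (fCat c') \<mu> \<nu> \<Longrightarrow>
      whisker (Cmp (fCat c') \<eta>' \<eta>) f = Cmp (fCat c) (whisker \<eta>' f) (whisker \<eta> f)"

text \<open>\<open>FSum2 c \<kappa> \<mu> \<eta>\<close> is the arrow from \<open>FSum c \<kappa>\<close> to \<open>FSum c \<mu>\<close> induced by \<open>\<eta>\<close>.\<close>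

locale two_fam_Sigma_category =
  two_fam_category K fCat fcomp whisker +
  fam_Sigma_category K "\<lambda>c. Obj (fCat c)" fcomp FSum pr Sig
  for K :: "('o, 'a) cat" and fCat :: "'o \<Rightarrow> ('l, 'm) cat" and fcomp :: "'l \<Rightarrow> 'a \<Rightarrow> 'l"
    and whisker :: "'m \<Rightarrow> 'a \<Rightarrow> 'm"
    and FSum :: "'o \<Rightarrow> 'l \<Rightarrow> 'o" and pr :: "'o \<Rightarrow> 'l \<Rightarrow> 'a" and Sig :: "'l \<Rightarrow> 'a \<Rightarrow> 'a" +
  fixes FSum2 :: "'o \<Rightarrow> 'l \<Rightarrow> 'l \<Rightarrow> 'm \<Rightarrow> 'a"
  assumes Sum2_Hom: "c \<in> Obj K \<Longrightarrow> \<eta> \<in> Hom (fCat c) \<kappa> \<mu> \<Longrightarrow>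
      FSum2 c \<kappa> \<mu> \<eta> \<in> Hom K (FSum c \<kappa>) (FSum c \<mu>)"
    and Sum2_pr: "c \<in> Obj K \<Longrightarrow> \<eta> \<in> Hom (fCat c) \<kappa> \<mu> \<Longrightarrow>
      Cmp K (pr c \<mu>) (FSum2 c \<kappa> \<mu> \<eta>) = pr c \<kappa>"
    and Sum2_Sig: "f \<in> Hom K c c' \<Longrightarrow> \<eta> \<in> Hom (fCat c') \<kappa> \<mu> \<Longrightarrow>
      Cmp K (FSum2 c' \<kappa> \<mu> \<eta>) (Sig \<kappa> f) =
      Cmp K (Sig \<mu> f) (FSum2 c (fcomp \<kappa> f) (fcomp \<mu> f) (whisker \<eta> f))"
    and Sum2_Idn: "c \<in> Obj K \<Longrightarrow> \<kappa> \<in> Obj (fCat c) \<Longrightarrow>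
      FSum2 c \<kappa> \<kappa> (Idn (fCat c) \<kappa>) = Idn K (FSum c \<kappa>)"
    and Sum2_Cmp: "c \<in> Obj K \<Longrightarrow> \<eta>' \<in> Hom (fCat c) \<nu> \<kappa> \<Longrightarrow> \<eta> \<in> Hom (fCat c) \<kappa> \<mu> \<Longrightarrow>
      Cmp K (FSum2 c \<kappa> \<mu> \<eta>) (FSum2 c \<nu> \<kappa> \<eta>') = FSum2 c \<nu> \<mu> (Cmp (fCat c) \<eta> \<eta>')"


section \<open>The category of categories with a base of computability\<close>

text \<open>The universe of which all objects and arrows of the categories in \<open>CatBaseComp\<close>, and all
  elements of the sets in \<open>Sets\<close>, are members. It is the free closure of an arbitrary type under
  the two tuple formations of the category of elements: \<open>Elt c x\<close> is the pair (c,x), and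
  \<open>EArr e f e'\<close> is the arrow from e to e' with underlying arrow f. Up to bijection it is an
  arbitrary infinite type.\<close>

datatype 'v univ =
    Atom 'v
  | Elt (eobj: "'v univ") (eelt: "'v univ")
  | EArr (esrc: "'v univ") (eund: "'v univ") (etgt: "'v univ")

type_synonym 'v ucat = "('v univ, 'v univ) cat"
type_synonym 'v ubase = "'v univ \<Rightarrow> 'v univ set"
type_synonym 'v catbase = "'v ucat \<times> 'v ubase"
type_synonym 'v ufunc = "('v univ, 'v univ, 'v univ, 'v univ) func"
type_synonym 'v transfer = "('v catbase, 'v ufunc) arr"
type_synonym 'v set_arr = "('v univ set, 'v univ \<Rightarrow> 'v univ) arr"
type_synonym 'v presheaf = "('v univ, 'v univ, 'v univ set, 'v set_arr) func"
type_synonym 'v presheaf_arr = "('v presheaf, 'v univ \<Rightarrow> 'v set_arr) arr"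

definition CatBaseComp_Obj :: "'v catbase set" where
  "CatBaseComp_Obj = {(C, B). category C \<and> extensional_cat C \<and> base_of_computability C B}"

definition CatBaseComp :: "('v catbase, 'v transfer) cat" where
  "CatBaseComp =
     \<lparr>Obj = CatBaseComp_Obj,
      Mor = {Arr (C, B) F (D, B') | C B F D B'.
               (C, B) \<in> CatBaseComp_Obj \<and> (D, B') \<in> CatBaseComp_Obj \<and>
               computability_transfer C B D B' F},
      Src = asrc, Tgt = atgt,
      Idn = (\<lambda>X. Arr X (id_func (fst X)) X),
      Cmp = (\<lambda>G F. Arr (asrc F) (comp_func (fst (asrc F)) (amap G) (amap F)) (atgt G))\<rparr>"

text \<open>The family arrows over (C,B) are the functors from the opposite of C to \<open>Sets\<close>, and the
  2-family arrows are the natural transformations between them.\<close>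

definition fCat_CBC :: "'v catbase \<Rightarrow> ('v presheaf, 'v presheaf_arr) cat" where
  "fCat_CBC X = functor_cat (op_cat (fst X)) Sets"

definition fcomp_CBC :: "'v presheaf \<Rightarrow> 'v transfer \<Rightarrow> 'v presheaf" where
  "fcomp_CBC P F = comp_func (op_cat (fst (asrc F))) P (amap F)"

text \<open>Horizontal composition of a natural transformation with a functor: the component at d is the
  component of \<open>\<eta>\<close> at F(d).\<close>

definition whisker_CBC :: "'v presheaf_arr \<Rightarrow> 'v transfer \<Rightarrow> 'v presheaf_arr" where
  "whisker_CBC \<eta> F =
     Arr (fcomp_CBC (asrc \<eta>) F)
         (compose (Obj (fst (asrc F))) (amap \<eta>) (Fob (amap F)))
         (fcomp_CBC (atgt \<eta>) F)"

text \<open>An arrow from (c,x) to (d,y) is an arrow f from c to d with P(f)(y) = x.\<close>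

definition elements :: "'v ucat \<Rightarrow> 'v presheaf \<Rightarrow> 'v ucat" where
  "elements C P =
     (let Ob = {Elt c x | c x. c \<in> Obj C \<and> x \<in> Fob P c};
          M = {EArr (Elt c x) f (Elt d y) | c x f d y.
                 f \<in> Hom C c d \<and> x \<in> Fob P c \<and> y \<in> Fob P d \<and> amap (Far P f) y = x}
      in \<lparr>Obj = Ob, Mor = M,
          Src = restrict esrc M, Tgt = restrict etgt M,
          Idn = (\<lambda>e\<in>Ob. EArr e (Idn C (eobj e)) e),
          Cmp = (\<lambda>g f. if f \<in> M \<and> g \<in> M \<and> etgt f = esrc g
                        then EArr (esrc f) (Cmp C (eund g) (eund f)) (etgt g)
                        else undefined)\<rparr>)"

definition elements_pr :: "'v ucat \<Rightarrow> 'v presheaf \<Rightarrow> 'v ufunc" where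
  "elements_pr C P =
     \<lparr>Fob = restrict eobj (Obj (elements C P)), Far = restrict eund (Mor (elements C P))\<rparr>"

definition elements_base :: "'v ucat \<Rightarrow> 'v ubase \<Rightarrow> 'v presheaf \<Rightarrow> 'v ubase" where
  "elements_base C B P =
     (\<lambda>e\<in>Obj (elements C P).
        {i. mono_arrow (elements C P) i \<and> Tgt (elements C P) i = e \<and>
            Far (elements_pr C P) i \<in> B (Fob (elements_pr C P) e) \<and>
            cartesian_arrow (elements C P) C (elements_pr C P) i})"

definition Sum_CBC :: "'v catbase \<Rightarrow> 'v presheaf \<Rightarrow> 'v catbase" where
  "Sum_CBC X P = (elements (fst X) P, elements_base (fst X) (snd X) P)"

definition pr_CBC :: "'v catbase \<Rightarrow> 'v presheaf \<Rightarrow> 'v transfer" where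
  "pr_CBC X P = Arr (Sum_CBC X P) (elements_pr (fst X) P) X"

definition Sig_CBC :: "'v presheaf \<Rightarrow> 'v transfer \<Rightarrow> 'v transfer" where
  "Sig_CBC P F =
     (let E = elements (fst (asrc F)) (fcomp_CBC P F);
          ob = (\<lambda>e. Elt (Fob (amap F) (eobj e)) (eelt e))
      in Arr (Sum_CBC (asrc F) (fcomp_CBC P F))
             \<lparr>Fob = restrict ob (Obj E),
              Far = (\<lambda>u\<in>Mor E. EArr (ob (esrc u)) (Far (amap F) (eund u)) (ob (etgt u)))\<rparr>
             (Sum_CBC (atgt F) P))"

definition Sum2_CBC ::
  "'v catbase \<Rightarrow> 'v presheaf \<Rightarrow> 'v presheaf \<Rightarrow> 'v presheaf_arr \<Rightarrow> 'v transfer" where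
  "Sum2_CBC X P S \<eta> =
     (let E = elements (fst X) P;
          ob = (\<lambda>e. Elt (eobj e) (amap (amap \<eta> (eobj e)) (eelt e)))
      in Arr (Sum_CBC X P)
             \<lparr>Fob = restrict ob (Obj E),
              Far = (\<lambda>u\<in>Mor E. EArr (ob (esrc u)) (eund u) (ob (etgt u)))\<rparr>
             (Sum_CBC X S))"

end

theory Submission
  imports Defs
begin

text \<open>The projection from the category of elements of a presheaf \<open>P\<close> to its base \<open>C\<close> is a discrete
  fibration: an arrow \<open>f\<close> of \<open>C\<close> has exactly one lift with a given codomain, and the domain of that
  lift carries the restriction of the element along \<open>f\<close> (\<open>elements_lift\<close>, \<open>elements_factor\<close>). Hence
  everything that the theorem asks about the category of elements is decided by underlying arrows.
  Every arrow is cartesian, arrows over monos are mono, and a square is a pullback iff its image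
  in \<open>C\<close> is one (\<open>elements_pullback_iff\<close>). So the sum carries a base of computability
  (\<open>base_elements\<close>), its projection is a transfer, and a functor into it is a transfer as soon as
  its composite with the projection is one (\<open>elements_functor_transfer\<close>).

  On top of this, the sum of \<open>P\<close> over \<open>X\<close> has a universal property: transfers from \<open>Z\<close> into it
  correspond to pairs of a transfer \<open>T\<close> from \<open>Z\<close> to \<open>X\<close> and a compatible family, which assigns to
  every object \<open>z\<close> an element of \<open>P(T(z))\<close> and respects restriction (\<open>pair_CBC\<close> for existence,
  \<open>Sum_CBC_eqI\<close> for uniqueness). Both kinds of arrows between sums come from it. The arrow over a
  transfer \<open>F\<close> is the pair of \<open>F\<close> after the first projection and the tautological family, and the
  arrow induced by a natural transformation \<open>\<eta>\<close> is the pair of the first projection and the image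
  of that family under \<open>\<eta>\<close>, which is compatible because \<open>\<eta>\<close> is natural. The pullback
  property holds because a compatible family for \<open>P\<close> composed with \<open>F\<close>, over a transfer \<open>H\<close>, is the
  same thing as a compatible family for \<open>P\<close> over \<open>F\<close> after \<open>H\<close>. The equations between arrows into a
  sum follow from the uniqueness half, by comparing first projections and elements.\<close>


section \<open>Categories, functors and transfers\<close>

lemma Hom_iff: "f \<in> Hom C a b \<longleftrightarrow> f \<in> Mor C \<and> Src C f = a \<and> Tgt C f = b"
  by (simp add: Hom_def)

lemma (in category) Hom_Obj: "f \<in> Hom C a b \<Longrightarrow> a \<in> Obj C \<and> b \<in> Obj C"
  using Src_Obj Tgt_Obj by (auto simp: Hom_iff)

lemma func_eqI: "Fob F = Fob G \<Longrightarrow> Far F = Far G \<Longrightarrow> F = (G :: ('o, 'a, 'p, 'b) func)"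
  by (cases F, cases G) simp

lemma is_functorI:
  assumes "Fob F \<in> Obj C \<rightarrow>\<^sub>E Obj D" "Far F \<in> extensional (Mor C)"
    and "\<And>a b f. f \<in> Hom C a b \<Longrightarrow> Far F f \<in> Hom D (Fob F a) (Fob F b)"
    and "\<And>a. a \<in> Obj C \<Longrightarrow> Far F (Idn C a) = Idn D (Fob F a)"
    and "\<And>a b c f g. f \<in> Hom C a b \<Longrightarrow> g \<in> Hom C b c \<Longrightarrow>
      Far F (Cmp C g f) = Cmp D (Far F g) (Far F f)"
  shows "is_functor C D F"
proof -
  have "Far F f \<in> Mor D" if "f \<in> Mor C" for f
    using assms(3)[of f "Src C f" "Tgt C f"] that by (auto simp: Hom_iff)
  with assms show ?thesis unfolding is_functor_def PiE_def by blast
qed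

lemma functor_Fob: "is_functor C D F \<Longrightarrow> a \<in> Obj C \<Longrightarrow> Fob F a \<in> Obj D"
  and functor_Far: "is_functor C D F \<Longrightarrow> f \<in> Hom C a b \<Longrightarrow> Far F f \<in> Hom D (Fob F a) (Fob F b)"
  and functor_Idn: "is_functor C D F \<Longrightarrow> a \<in> Obj C \<Longrightarrow> Far F (Idn C a) = Idn D (Fob F a)"
  and functor_Cmp: "is_functor C D F \<Longrightarrow> f \<in> Hom C a b \<Longrightarrow> g \<in> Hom C b c \<Longrightarrow>
      Far F (Cmp C g f) = Cmp D (Far F g) (Far F f)"
  and functor_Fob_ext: "is_functor C D F \<Longrightarrow> Fob F \<in> extensional (Obj C)"
  and functor_Far_ext: "is_functor C D F \<Longrightarrow> Far F \<in> extensional (Mor C)"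
  unfolding is_functor_def by (auto simp: PiE_def)

lemma functor_eqI:
  assumes "is_functor C D F" "is_functor C D' G"
    and "\<And>a. a \<in> Obj C \<Longrightarrow> Fob F a = Fob G a" "\<And>f. f \<in> Mor C \<Longrightarrow> Far F f = Far G f"
  shows "F = G"
  using assms by (intro func_eqI extensionalityI[where A = "Obj C"]
      extensionalityI[where A = "Mor C"]) (auto intro: functor_Fob_ext functor_Far_ext)

lemma comp_func_simps:
  "a \<in> Obj C \<Longrightarrow> Fob (comp_func C G F) a = Fob G (Fob F a)"
  "f \<in> Mor C \<Longrightarrow> Far (comp_func C G F) f = Far G (Far F f)"
  "f \<in> Hom C a b \<Longrightarrow> Far (comp_func C G F) f = Far G (Far F f)"
  by (auto simp: comp_func_def compose_def Hom_iff)

lemma comp_func_op: "comp_func (op_cat C) = comp_func C"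
  by (intro ext) (simp add: comp_func_def op_cat_def)

lemma id_func_simps:
  "a \<in> Obj C \<Longrightarrow> Fob (id_func C) a = a"
  "f \<in> Mor C \<Longrightarrow> Far (id_func C) f = f"
  "f \<in> Hom C a b \<Longrightarrow> Far (id_func C) f = f"
  by (auto simp: id_func_def Hom_iff)

lemma (in category) is_functor_comp:
  assumes F: "is_functor C D F" and G: "is_functor D E G"
  shows "is_functor C E (comp_func C G F)"
proof (rule is_functorI)
  show "Fob (comp_func C G F) \<in> Obj C \<rightarrow>\<^sub>E Obj E"
    using functor_Fob[OF G functor_Fob[OF F]] by (auto simp: comp_func_def compose_def)
  show "Far (comp_func C G F) \<in> extensional (Mor C)"
    by (simp add: comp_func_def)
  fix a b c f g
  assume f: "f \<in> Hom C a b"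
  then show "Far (comp_func C G F) f \<in> Hom E (Fob (comp_func C G F) a) (Fob (comp_func C G F) b)"
    using functor_Far[OF G functor_Far[OF F f]] Hom_Obj[OF f] by (simp add: comp_func_simps)
  assume g: "g \<in> Hom C b c"
  show "Far (comp_func C G F) (Cmp C g f)
      = Cmp E (Far (comp_func C G F) g) (Far (comp_func C G F) f)"
    using functor_Cmp[OF F f g] functor_Cmp[OF G functor_Far[OF F f] functor_Far[OF F g]]
      f g Cmp_Hom[OF f g] by (simp add: comp_func_simps)
next
  fix a assume a: "a \<in> Obj C"
  then show "Far (comp_func C G F) (Idn C a) = Idn E (Fob (comp_func C G F) a)"
    using functor_Idn[OF F a] functor_Idn[OF G functor_Fob[OF F a]] Idn_Hom[OF a]
    by (simp add: comp_func_simps)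
qed

lemma (in category) is_functor_id: "is_functor C C (id_func C)"
proof (rule is_functorI)
  show "Fob (id_func C) \<in> Obj C \<rightarrow>\<^sub>E Obj C" "Far (id_func C) \<in> extensional (Mor C)"
    by (auto simp: id_func_def)
  show "Far (id_func C) f \<in> Hom C (Fob (id_func C) a) (Fob (id_func C) b)"
    if "f \<in> Hom C a b" for a b f
    using that Hom_Obj[OF that] by (simp add: id_func_simps)
  show "Far (id_func C) (Idn C a) = Idn C (Fob (id_func C) a)" if "a \<in> Obj C" for a
    using that Idn_Hom[OF that] by (simp add: id_func_simps)
  show "Far (id_func C) (Cmp C g f) = Cmp C (Far (id_func C) g) (Far (id_func C) f)"
    if "f \<in> Hom C a b" "g \<in> Hom C b c" for a b c f g
    using that Cmp_Hom[OF that] by (simp add: id_func_simps)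
qed

lemma comp_func_id_right: "is_functor C D F \<Longrightarrow> comp_func C F (id_func C) = F"
  by (rule func_eqI) (auto simp: comp_func_def id_func_def is_functor_def PiE_def intro!: compose_Id)

lemma comp_func_id_left: "is_functor C D F \<Longrightarrow> comp_func C (id_func D) F = F"
  by (rule func_eqI) (auto simp: comp_func_def id_func_def is_functor_def PiE_def intro!: Id_compose)

lemma comp_func_assoc:
  "is_functor C D F \<Longrightarrow> comp_func C H (comp_func C G F) = comp_func C (comp_func D H G) F"
  by (rule func_eqI) (auto simp: comp_func_def is_functor_def PiE_def intro!: compose_assoc)

lemma category_op:
  assumes "category C"
  shows "category (op_cat C)"
proof -
  interpret category C by fact
  have H: "Hom (op_cat C) a b = Hom C b a" for a b
    by (auto simp: Hom_iff op_cat_def)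
  show ?thesis
    by unfold_locales (auto simp: H Idn_Hom Cmp_Hom Idn_right Idn_left Cmp_assoc,
       auto simp: op_cat_def Src_Obj Tgt_Obj Idn_Hom Cmp_Hom Idn_right Idn_left Cmp_assoc)
qed

lemma is_functor_op: "is_functor C D F \<Longrightarrow> is_functor (op_cat C) (op_cat D) F"
  unfolding is_functor_def by (auto simp: op_cat_def Hom_iff)

lemma is_pullbackD:
  assumes "is_pullback C p q f g"
  shows "p \<in> Hom C (Src C p) (Src C f)" "q \<in> Hom C (Src C p) (Src C g)"
    "f \<in> Hom C (Src C f) (Tgt C g)" "g \<in> Hom C (Src C g) (Tgt C g)"
    "Cmp C f p = Cmp C g q"
  using assms unfolding is_pullback_def by (simp_all add: Hom_iff)

lemma is_pullback_universal:
  "\<lbrakk>is_pullback C p q f g; z \<in> Obj C; h \<in> Hom C z (Src C f); k \<in> Hom C z (Src C g);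
    Cmp C f h = Cmp C g k\<rbrakk> \<Longrightarrow> \<exists>!u. u \<in> Hom C z (Src C p) \<and> Cmp C p u = h \<and> Cmp C q u = k"
  unfolding is_pullback_def by blast

lemma is_pullbackI:
  assumes "p \<in> Hom C r s" "q \<in> Hom C r t" "f \<in> Hom C s b" "g \<in> Hom C t b"
    "Cmp C f p = Cmp C g q"
    "\<And>z h k. \<lbrakk>z \<in> Obj C; h \<in> Hom C z s; k \<in> Hom C z t; Cmp C f h = Cmp C g k\<rbrakk>
      \<Longrightarrow> \<exists>!u. u \<in> Hom C z r \<and> Cmp C p u = h \<and> Cmp C q u = k"
  shows "is_pullback C p q f g"
proof -
  have "Src C p = r" "Src C f = s" "Src C g = t"
    using assms(1,3,4) by (simp_all add: Hom_iff)
  then show ?thesis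
    using assms unfolding is_pullback_def by (simp add: Hom_iff[of p] Hom_iff[of q] Hom_iff[of f] Hom_iff[of g])
qed

lemma transfer_functor: "computability_transfer C B D B' F \<Longrightarrow> is_functor C D F"
  and transfer_base: "computability_transfer C B D B' F \<Longrightarrow> a \<in> Obj C \<Longrightarrow> i \<in> B a \<Longrightarrow>
      Far F i \<in> B' (Fob F a)"
  and transfer_pullback: "computability_transfer C B D B' F \<Longrightarrow> b \<in> Obj C \<Longrightarrow> j \<in> B b \<Longrightarrow>
      is_pullback C p q f j \<Longrightarrow> is_pullback D (Far F p) (Far F q) (Far F f) (Far F j)"
  unfolding computability_transfer_def by blast+

lemma mono_Mor: "mono_arrow C i \<Longrightarrow> i \<in> Mor C"
  by (simp add: mono_arrow_def)

lemma mono_cancel: "mono_arrow C i \<Longrightarrow> h \<in> Hom C z (Src C i) \<Longrightarrow> k \<in> Hom C z (Src C i) \<Longrightarrow>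
    Cmp C i h = Cmp C i k \<Longrightarrow> h = k"
  unfolding mono_arrow_def by blast

lemma base_mono: "base_of_computability C B \<Longrightarrow> a \<in> Obj C \<Longrightarrow> i \<in> B a \<Longrightarrow> mono_arrow C i"
  and base_Hom: "base_of_computability C B \<Longrightarrow> a \<in> Obj C \<Longrightarrow> i \<in> B a \<Longrightarrow> i \<in> Hom C (Src C i) a"
  and base_Idn: "base_of_computability C B \<Longrightarrow> a \<in> Obj C \<Longrightarrow> Idn C a \<in> B a"
  unfolding base_of_computability_def by (auto simp: Hom_iff dest: mono_Mor)

lemma base_pullback: "base_of_computability C B \<Longrightarrow> a \<in> Obj C \<Longrightarrow> i \<in> B a \<Longrightarrow>
    b \<in> Obj C \<Longrightarrow> j \<in> B b \<Longrightarrow> f \<in> Hom C (Src C i) b \<Longrightarrow>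
    \<exists>p q. is_pullback C p q f j \<and> Cmp C i p \<in> B a"
  unfolding base_of_computability_def by blast

text \<open>A transfer is only required to preserve pullbacks of base arrows. This passes to composites
  because the first transfer turns a base arrow into a base arrow.\<close>

lemma (in category) transfer_comp:
  assumes B: "base_of_computability C B"
    and F: "computability_transfer C B D B' F" and G: "computability_transfer D B' E B'' G"
  shows "computability_transfer C B E B'' (comp_func C G F)"
  unfolding computability_transfer_def
proof (intro conjI ballI allI impI)
  note fF = transfer_functor[OF F]
  show "is_functor C E (comp_func C G F)"
    using is_functor_comp[OF fF transfer_functor[OF G]] .
  show "Far (comp_func C G F) i \<in> B'' (Fob (comp_func C G F) a)"
    if "a \<in> Obj C" "i \<in> B a" for a i
    using transfer_base[OF G functor_Fob[OF fF that(1)] transfer_base[OF F that]]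
      that base_Hom[OF B that] by (simp add: comp_func_simps)
  show "is_pullback E (Far (comp_func C G F) p) (Far (comp_func C G F) q)
      (Far (comp_func C G F) f) (Far (comp_func C G F) j)"
    if "b \<in> Obj C" "j \<in> B b" "is_pullback C p q f j" for b j f p q
    using transfer_pullback[OF G functor_Fob[OF fF that(1)] transfer_base[OF F that(1,2)]
        transfer_pullback[OF F that]] is_pullbackD(1-4)[OF that(3)]
    by (simp add: comp_func_simps)
qed

lemma (in category) transfer_id:
  assumes B: "base_of_computability C B"
  shows "computability_transfer C B C B (id_func C)"
  unfolding computability_transfer_def
proof (intro conjI ballI allI impI)
  show "is_functor C C (id_func C)" by (rule is_functor_id)
  show "Far (id_func C) i \<in> B (Fob (id_func C) a)" if "a \<in> Obj C" "i \<in> B a" for a i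
    using that base_Hom[OF B that] by (simp add: id_func_simps)
  show "is_pullback C (Far (id_func C) p) (Far (id_func C) q) (Far (id_func C) f) (Far (id_func C) j)"
    if "is_pullback C p q f j" for f j p q
    using that is_pullbackD(1-4)[OF that] by (simp add: id_func_simps)
qed

section \<open>Natural transformations\<close>

lemma nat_trans_Hom: "nat_trans C D F G \<eta> \<Longrightarrow> a \<in> Obj C \<Longrightarrow> \<eta> a \<in> Hom D (Fob F a) (Fob G a)"
  and nat_trans_square: "nat_trans C D F G \<eta> \<Longrightarrow> f \<in> Hom C a b \<Longrightarrow>
      Cmp D (\<eta> b) (Far F f) = Cmp D (Far G f) (\<eta> a)"
  and nat_trans_ext: "nat_trans C D F G \<eta> \<Longrightarrow> \<eta> \<in> extensional (Obj C)"
  unfolding nat_trans_def by auto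

lemma nat_trans_id:
  assumes "category C" "category D" and F: "is_functor C D F"
  shows "nat_trans C D F F (\<lambda>a\<in>Obj C. Idn D (Fob F a))"
proof -
  interpret C: category C by fact
  interpret D: category D by fact
  have "Cmp D (Idn D (Fob F b)) (Far F f) = Cmp D (Far F f) (Idn D (Fob F a))"
    if "f \<in> Hom C a b" for a b f
    using D.Idn_left[OF functor_Far[OF F that]] D.Idn_right[OF functor_Far[OF F that]] by simp
  then show ?thesis
    unfolding nat_trans_def using C.Hom_Obj functor_Fob[OF F] D.Idn_Hom by simp
qed

lemma nat_trans_comp:
  assumes "category C" "category D"
    and F: "is_functor C D F" and G: "is_functor C D G" and H: "is_functor C D H"
    and \<eta>: "nat_trans C D F G \<eta>" and \<theta>: "nat_trans C D G H \<theta>"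
  shows "nat_trans C D F H (\<lambda>a\<in>Obj C. Cmp D (\<theta> a) (\<eta> a))"
proof -
  interpret C: category C by fact
  interpret D: category D by fact
  have "Cmp D (Cmp D (\<theta> b) (\<eta> b)) (Far F f) = Cmp D (Far H f) (Cmp D (\<theta> a) (\<eta> a))"
    if f: "f \<in> Hom C a b" for a b f
  proof -
    have a: "a \<in> Obj C" and b: "b \<in> Obj C" using C.Hom_Obj[OF f] by auto
    note \<eta>a = nat_trans_Hom[OF \<eta> a] and \<eta>b = nat_trans_Hom[OF \<eta> b]
      and \<theta>a = nat_trans_Hom[OF \<theta> a] and \<theta>b = nat_trans_Hom[OF \<theta> b]
    show ?thesis
      using D.Cmp_assoc[OF functor_Far[OF F f] \<eta>b \<theta>b] D.Cmp_assoc[OF \<eta>a functor_Far[OF G f] \<theta>b]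
        D.Cmp_assoc[OF \<eta>a \<theta>a functor_Far[OF H f]]
        nat_trans_square[OF \<eta> f] nat_trans_square[OF \<theta> f] by simp
  qed
  then show ?thesis
    unfolding nat_trans_def
    using C.Hom_Obj D.Cmp_Hom[OF nat_trans_Hom[OF \<eta>] nat_trans_Hom[OF \<theta>]] by simp
qed

lemma nat_trans_whisker:
  assumes "category C" and F: "is_functor C D F" and \<eta>: "nat_trans D E G H \<eta>"
  shows "nat_trans C E (comp_func C G F) (comp_func C H F) (compose (Obj C) \<eta> (Fob F))"
proof -
  interpret C: category C by fact
  show ?thesis
    unfolding nat_trans_def
    using C.Hom_Obj nat_trans_Hom[OF \<eta> functor_Fob[OF F]] nat_trans_square[OF \<eta> functor_Far[OF F]]
    by (simp add: comp_func_simps compose_def)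
qed

lemma Hom_functor_cat: "m \<in> Hom (functor_cat C D) F G \<longleftrightarrow>
    is_functor C D F \<and> is_functor C D G \<and> (\<exists>\<eta>. m = Arr F \<eta> G \<and> nat_trans C D F G \<eta>)"
  by (auto simp: Hom_iff functor_cat_def)

lemma functor_cat_simps:
  "F \<in> Obj (functor_cat C D) \<longleftrightarrow> is_functor C D F"
  "Idn (functor_cat C D) F = Arr F (\<lambda>a\<in>Obj C. Idn D (Fob F a)) F"
  "Cmp (functor_cat C D) (Arr G' \<theta> H) (Arr F \<eta> G) = Arr F (\<lambda>a\<in>Obj C. Cmp D (\<theta> a) (\<eta> a)) H"
  by (simp_all add: functor_cat_def)

lemma category_functor_cat:
  assumes "category C" "category D"
  shows "category (functor_cat C D)"
proof
  interpret C: category C by fact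
  interpret D: category D by fact
  let ?F = "functor_cat C D"
  show "Src ?F m \<in> Obj ?F" "Tgt ?F m \<in> Obj ?F" if "m \<in> Mor ?F" for m
    using that by (auto simp: functor_cat_def)
  show "Idn ?F F \<in> Hom ?F F F" if "F \<in> Obj ?F" for F
    using that nat_trans_id[OF assms] by (simp add: functor_cat_simps Hom_functor_cat)
  fix F G H L m n l
  assume m: "m \<in> Hom ?F F G"
  then obtain \<eta> where m': "m = Arr F \<eta> G" "nat_trans C D F G \<eta>"
    by (auto simp: Hom_functor_cat)
  show "Cmp ?F m (Idn ?F F) = m" "Cmp ?F (Idn ?F G) m = m"
    unfolding m' functor_cat_simps
    using D.Idn_right[OF nat_trans_Hom[OF m'(2)]] D.Idn_left[OF nat_trans_Hom[OF m'(2)]]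
      nat_trans_ext[OF m'(2)]
    by (auto intro!: extensionalityI[where A = "Obj C"])
  assume n: "n \<in> Hom ?F G H"
  then obtain \<theta> where n': "n = Arr G \<theta> H" "nat_trans C D G H \<theta>"
    by (auto simp: Hom_functor_cat)
  show "Cmp ?F n m \<in> Hom ?F F H"
    using m n nat_trans_comp[OF assms _ _ _ m'(2) n'(2)]
    unfolding m' n' functor_cat_simps by (simp add: Hom_functor_cat)
  assume "l \<in> Hom ?F H L"
  then obtain \<kappa> where l': "l = Arr H \<kappa> L" "nat_trans C D H L \<kappa>"
    by (auto simp: Hom_functor_cat)
  show "Cmp ?F l (Cmp ?F n m) = Cmp ?F (Cmp ?F l n) m"
    unfolding m' n' l' functor_cat_simps
    using D.Cmp_assoc[OF nat_trans_Hom[OF m'(2)] nat_trans_Hom[OF n'(2)] nat_trans_Hom[OF l'(2)]]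
    by (auto intro!: restrict_ext)
qed


section \<open>Presheaves\<close>

text \<open>An arrow \<open>f\<close> from \<open>c\<close> to \<open>d\<close> acts contravariantly: this is the restriction along \<open>f\<close> of an
  element \<open>y\<close> over \<open>d\<close>.\<close>

abbreviation act :: "'v presheaf \<Rightarrow> 'v univ \<Rightarrow> 'v univ \<Rightarrow> 'v univ" where
  "act P f y \<equiv> amap (Far P f) y"

lemma Hom_Sets: "u \<in> Hom Sets A B \<longleftrightarrow> (\<exists>f \<in> A \<rightarrow>\<^sub>E B. u = Arr A f B)"
  by (auto simp: Hom_iff Sets_def)

lemma category_Sets: "category Sets"
proof unfold_locales
  show "Src Sets f \<in> Obj Sets" "Tgt Sets f \<in> Obj Sets" for f :: "('u set, 'u \<Rightarrow> 'u) arr"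
    by (auto simp: Sets_def)
  show "Idn Sets A \<in> Hom Sets A A" for A :: "'u set"
    by (auto simp: Sets_def Hom_iff)
  fix A B C D :: "'u set" and f g h
  assume f: "f \<in> Hom Sets A B"
  then show "Cmp Sets f (Idn Sets A) = f" "Cmp Sets (Idn Sets B) f = f"
    by (auto simp: Hom_Sets) (auto simp: Sets_def Id_compose compose_Id PiE_def)
  assume g: "g \<in> Hom Sets B C"
  with f show "Cmp Sets g f \<in> Hom Sets A C"
    by (auto simp: Hom_Sets) (auto simp: Sets_def compose_def PiE_mem)
  assume "h \<in> Hom Sets C D"
  with f g show "Cmp Sets h (Cmp Sets g f) = Cmp Sets (Cmp Sets h g) f"
    by (auto simp: Hom_Sets) (auto simp: Sets_def compose_def PiE_mem fun_eq_iff)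
qed

locale presheaf = category C for C :: "'v ucat" +
  fixes P :: "'v presheaf"
  assumes P_functor: "is_functor (op_cat C) Sets P"
begin

lemma Hom_op: "Hom (op_cat C) a b = Hom C b a"
  by (auto simp: Hom_iff op_cat_def)

lemma Far_Hom: "f \<in> Hom C c d \<Longrightarrow> Far P f \<in> Hom Sets (Fob P d) (Fob P c)"
  using functor_Far[OF P_functor, of f d c] by (simp add: Hom_op)

lemma act_mem: "f \<in> Hom C c d \<Longrightarrow> y \<in> Fob P d \<Longrightarrow> act P f y \<in> Fob P c"
  using Far_Hom[of f c d] by (auto simp: Hom_Sets)

lemma act_Idn: "c \<in> Obj C \<Longrightarrow> x \<in> Fob P c \<Longrightarrow> act P (Idn C c) x = x"
  using functor_Idn[OF P_functor, of c] by (simp add: op_cat_def Sets_def)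

lemma act_Cmp:
  assumes "f \<in> Hom C c d" "g \<in> Hom C d e" "y \<in> Fob P e"
  shows "act P (Cmp C g f) y = act P f (act P g y)"
  using functor_Cmp[OF P_functor, of g e d f c] Far_Hom[OF assms(1)] Far_Hom[OF assms(2)] assms
  by (auto simp: Hom_op Hom_Sets) (auto simp: op_cat_def Sets_def compose_def)

end


section \<open>The category of elements\<close>

context presheaf
begin

abbreviation El :: "'v ucat" where "El \<equiv> elements C P"

lemma elements_fields:
  "Obj El = {Elt c x | c x. c \<in> Obj C \<and> x \<in> Fob P c}"
  "Mor El = {EArr (Elt c x) f (Elt d y) | c x f d y.
     f \<in> Hom C c d \<and> x \<in> Fob P c \<and> y \<in> Fob P d \<and> act P f y = x}"
  "Src El = restrict esrc (Mor El)" "Tgt El = restrict etgt (Mor El)"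
  "Idn El = (\<lambda>e\<in>Obj El. EArr e (Idn C (eobj e)) e)"
  "Cmp El = (\<lambda>g f. if f \<in> Mor El \<and> g \<in> Mor El \<and> etgt f = esrc g
     then EArr (esrc f) (Cmp C (eund g) (eund f)) (etgt g) else undefined)"
  by (simp_all add: elements_def Let_def)

lemma Obj_El: "Elt c x \<in> Obj El \<longleftrightarrow> c \<in> Obj C \<and> x \<in> Fob P c"
  by (simp add: elements_fields)

lemma Obj_ElD:
  assumes "e \<in> Obj El"
  shows "Elt (eobj e) (eelt e) = e" "eobj e \<in> Obj C" "eelt e \<in> Fob P (eobj e)"
  using assms by (auto simp: elements_fields)

lemma EArr_Hom_El:
  "EArr e f e' \<in> Hom El e1 e2 \<longleftrightarrow> e1 = e \<and> e2 = e' \<and> e \<in> Obj El \<and> e' \<in> Obj El \<and>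
     f \<in> Hom C (eobj e) (eobj e') \<and> act P f (eelt e') = eelt e"
  by (auto simp: Hom_iff elements_fields intro: Src_Obj Tgt_Obj)

lemma Hom_ElE:
  assumes "u \<in> Hom El e e'"
  obtains f where "u = EArr e f e'" "e \<in> Obj El" "e' \<in> Obj El"
     "f \<in> Hom C (eobj e) (eobj e')" "act P f (eelt e') = eelt e"
proof -
  have "\<exists>f. u = EArr e f e'"
    using assms by (auto simp: Hom_iff elements_fields)
  with that assms show ?thesis by (auto simp: EArr_Hom_El)
qed

lemma Mor_El_ends:
  assumes "u \<in> Mor El"
  shows "Src El u = esrc u" "Tgt El u = etgt u" "esrc u \<in> Obj El" "etgt u \<in> Obj El"
  using assms by (auto simp: elements_fields Hom_Obj)

lemma Idn_El: "e \<in> Obj El \<Longrightarrow> Idn El e = EArr e (Idn C (eobj e)) e"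
  by (simp add: elements_fields)

lemma Cmp_El:
  assumes "u \<in> Hom El e e'" "v \<in> Hom El e' e''"
  shows "Cmp El v u = EArr e (Cmp C (eund v) (eund u)) e''"
  using assms by (auto simp: elements_fields Hom_iff)

lemma elements_faithful:
  "u \<in> Hom El e e' \<Longrightarrow> v \<in> Hom El e e' \<Longrightarrow> eund u = eund v \<Longrightarrow> u = v"
  by (auto elim!: Hom_ElE)

lemma Hom_El_Obj: "u \<in> Hom El e e' \<Longrightarrow> e \<in> Obj El \<and> e' \<in> Obj El"
  by (auto elim: Hom_ElE)

lemma eund_Hom: "u \<in> Hom El e e' \<Longrightarrow> eund u \<in> Hom C (eobj e) (eobj e')"
  by (auto elim: Hom_ElE)

lemma EArr_eund: "u \<in> Hom El e e' \<Longrightarrow> EArr e (eund u) e' = u"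
  by (auto elim: Hom_ElE)

lemma eund_Cmp: "u \<in> Hom El e e' \<Longrightarrow> v \<in> Hom El e' e'' \<Longrightarrow>
    eund (Cmp El v u) = Cmp C (eund v) (eund u)"
  by (simp add: Cmp_El)

lemma category_elements: "category El"
proof unfold_locales
  show "Src El f \<in> Obj El" "Tgt El f \<in> Obj El" if "f \<in> Mor El" for f
    using Hom_El_Obj[of f "Src El f" "Tgt El f"] that by (auto simp: Hom_iff)
  show idn: "Idn El a \<in> Hom El a a" if "a \<in> Obj El" for a
    using Obj_ElD[OF that] that by (simp add: Idn_El EArr_Hom_El Idn_Hom act_Idn)
  show cmp: "Cmp El g f \<in> Hom El a c"
    if f: "f \<in> Hom El a b" and g: "g \<in> Hom El b c" for a b c f g
    unfolding Cmp_El[OF f g] using f g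
    by (auto elim!: Hom_ElE simp: EArr_Hom_El act_Cmp Obj_ElD intro: Cmp_Hom)
  fix a b c d f g h
  assume f: "f \<in> Hom El a b"
  note ab = Hom_El_Obj[OF f, THEN conjunct1] Hom_El_Obj[OF f, THEN conjunct2]
  show "Cmp El f (Idn El a) = f"
    using Cmp_El[OF idn[OF ab(1)] f] EArr_eund[OF f] Idn_right[OF eund_Hom[OF f]] ab
    by (simp add: Idn_El)
  show "Cmp El (Idn El b) f = f"
    using Cmp_El[OF f idn[OF ab(2)]] EArr_eund[OF f] Idn_left[OF eund_Hom[OF f]] ab
    by (simp add: Idn_El)
  assume g: "g \<in> Hom El b c" and h: "h \<in> Hom El c d"
  show "Cmp El h (Cmp El g f) = Cmp El (Cmp El h g) f"
    using Cmp_assoc[OF eund_Hom[OF f] eund_Hom[OF g] eund_Hom[OF h]]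
    by (simp add: Cmp_El[OF cmp[OF f g] h] Cmp_El[OF f cmp[OF g h]] eund_Cmp f g h
        eund_Cmp[OF f g] eund_Cmp[OF g h])
qed

lemma extensional_elements: "extensional_cat El"
  unfolding extensional_cat_def elements_fields(3-6)
  by (simp add: elements_fields(3,4))

text \<open>The projection is a discrete fibration: the domain of a lift of \<open>f\<close> with codomain \<open>e'\<close> can
  only be the restriction of \<open>e'\<close> along \<open>f\<close>.\<close>

lemma elements_lift:
  "e' \<in> Obj El \<Longrightarrow> f \<in> Hom C c (eobj e') \<Longrightarrow>
     EArr (Elt c (act P f (eelt e'))) f e' \<in> Hom El (Elt c (act P f (eelt e'))) e'"
  using Hom_Obj act_mem Obj_ElD(3) by (simp add: EArr_Hom_El Obj_El)

text \<open>Since lifts are unique, a factorisation of underlying arrows is one of the arrows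
  themselves. This is why every arrow is cartesian.\<close>

lemma elements_factor:
  assumes u: "u \<in> Hom El e e'" and v: "v \<in> Hom El e'' e'"
    and h: "h \<in> Hom C (eobj e'') (eobj e)" "Cmp C (eund u) h = eund v"
  shows "EArr e'' h e \<in> Hom El e'' e" "Cmp El u (EArr e'' h e) = v"
proof -
  have "act P h (eelt e) = eelt e''"
    using u v h act_Cmp[OF h(1) eund_Hom[OF u], of "eelt e'"]
    by (auto elim!: Hom_ElE simp: Obj_ElD)
  then show *: "EArr e'' h e \<in> Hom El e'' e"
    using Hom_El_Obj[OF u] Hom_El_Obj[OF v] h by (simp add: EArr_Hom_El)
  show "Cmp El u (EArr e'' h e) = v"
    using Cmp_El[OF * u] h EArr_eund[OF v] by simp
qed

lemma pr_simps:
  "e \<in> Obj El \<Longrightarrow> Fob (elements_pr C P) e = eobj e"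
  "u \<in> Mor El \<Longrightarrow> Far (elements_pr C P) u = eund u"
  "u \<in> Hom El e e' \<Longrightarrow> Far (elements_pr C P) u = eund u"
  by (auto simp: elements_pr_def Hom_iff)

lemma elements_cartesian:
  assumes u: "u \<in> Hom El e e'"
  shows "cartesian_arrow El C (elements_pr C P) u"
  unfolding cartesian_arrow_def
proof (intro conjI ballI impI)
  have eu: "Src El u = e" "Tgt El u = e'" "u \<in> Mor El" using u by (auto simp: Hom_iff)
  show "u \<in> Mor El" by fact
  fix z v h
  assume z: "z \<in> Obj El" and "v \<in> Hom El z (Tgt El u)"
    and h: "h \<in> Hom C (Fob (elements_pr C P) z) (Fob (elements_pr C P) (Src El u))"
    and uh: "Cmp C (Far (elements_pr C P) u) h = Far (elements_pr C P) v"
  then have v: "v \<in> Hom El z e'" by (simp add: eu)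
  note w = elements_factor[OF u v, of h]
  show "\<exists>!w. w \<in> Hom El z (Src El u) \<and> Far (elements_pr C P) w = h \<and> Cmp El u w = v"
  proof (rule ex1I[of _ "EArr z h e"])
    show "EArr z h e \<in> Hom El z (Src El u) \<and> Far (elements_pr C P) (EArr z h e) = h
        \<and> Cmp El u (EArr z h e) = v"
      using w h uh u v z Hom_El_Obj[OF u] by (auto simp: eu pr_simps)
    show "w = EArr z h e"
      if "w \<in> Hom El z (Src El u) \<and> Far (elements_pr C P) w = h \<and> Cmp El u w = v" for w
      using that EArr_eund[of w z e] by (auto simp: eu pr_simps)
  qed
qed

lemma elements_mono:
  assumes u: "u \<in> Hom El e e'" and "mono_arrow C (eund u)"
  shows "mono_arrow El u"
  unfolding mono_arrow_def
proof (intro conjI allI ballI impI)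
  have eu: "Src El u = e" "u \<in> Mor El" using u by (auto simp: Hom_iff)
  show "u \<in> Mor El" by fact
  fix z h k
  assume "h \<in> Hom El z (Src El u)" "k \<in> Hom El z (Src El u)" and eq: "Cmp El u h = Cmp El u k"
  then have h: "h \<in> Hom El z e" and k: "k \<in> Hom El z e" by (auto simp: eu)
  have "eund h = eund k"
  proof (rule mono_cancel[OF assms(2)])
    show "eund h \<in> Hom C (eobj z) (Src C (eund u))" "eund k \<in> Hom C (eobj z) (Src C (eund u))"
      using eund_Hom[OF u] eund_Hom[OF h] eund_Hom[OF k] by (auto simp: Hom_iff)
    show "Cmp C (eund u) (eund h) = Cmp C (eund u) (eund k)"
      using arg_cong[OF eq, of eund] by (simp add: eund_Cmp[OF h u] eund_Cmp[OF k u])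
  qed
  with h k show "h = k" by (rule elements_faithful)
qed

text \<open>The universal property moves along unique lifts. From \<open>C\<close> upwards, the mediating arrow
  lifts because its composite with the underlying arrow of \<open>p\<close> is that of a leg of the cone. From the category of
  elements downwards, a cone in \<open>C\<close> must be lifted first, and this needs its two legs to give the
  same element at the tip.\<close>

lemma elements_pullback_iff:
  assumes p: "p \<in> Hom El r s" and q: "q \<in> Hom El r t" and f: "f \<in> Hom El s b"
    and g: "g \<in> Hom El t b"
  shows "is_pullback El p q f g \<longleftrightarrow> is_pullback C (eund p) (eund q) (eund f) (eund g)"
proof
  note up = eund_Hom[OF p] and uq = eund_Hom[OF q] and uf = eund_Hom[OF f] and ug = eund_Hom[OF g]
  have src: "Src El p = r" "Src El f = s" "Src El g = t" "Src C (eund p) = eobj r"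
    "Src C (eund f) = eobj s" "Src C (eund g) = eobj t"
    using p f g up uf ug by (auto simp: Hom_iff)
  {
    assume pb: "is_pullback C (eund p) (eund q) (eund f) (eund g)"
    show "is_pullback El p q f g"
    proof (rule is_pullbackI[OF p q f g])
      show "Cmp El f p = Cmp El g q"
        using is_pullbackD(5)[OF pb] Cmp_El[OF p f] Cmp_El[OF q g] by simp
      fix z h k
      assume z: "z \<in> Obj El" and h: "h \<in> Hom El z s" and k: "k \<in> Hom El z t"
        and eq: "Cmp El f h = Cmp El g k"
      have "Cmp C (eund f) (eund h) = Cmp C (eund g) (eund k)"
        using arg_cong[OF eq, of eund] by (simp add: eund_Cmp[OF h f] eund_Cmp[OF k g])
      then have ex1: "\<exists>!u. u \<in> Hom C (eobj z) (eobj r) \<and> Cmp C (eund p) u = eund h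
          \<and> Cmp C (eund q) u = eund k"
        using is_pullback_universal[OF pb Obj_ElD(2)[OF z], of "eund h" "eund k"]
          eund_Hom[OF h] eund_Hom[OF k] by (simp add: src)
      then obtain u where u: "u \<in> Hom C (eobj z) (eobj r)" "Cmp C (eund p) u = eund h"
        "Cmp C (eund q) u = eund k" by blast
      show "\<exists>!u. u \<in> Hom El z r \<and> Cmp El p u = h \<and> Cmp El q u = k"
      proof (rule ex1I[of _ "EArr z u r"])
        show "EArr z u r \<in> Hom El z r \<and> Cmp El p (EArr z u r) = h \<and> Cmp El q (EArr z u r) = k"
          using elements_factor[OF p h u(1,2)] elements_factor[OF q k u(1,3)] by blast
        fix v assume v: "v \<in> Hom El z r \<and> Cmp El p v = h \<and> Cmp El q v = k"
        then have vr: "v \<in> Hom El z r" by blast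
        have "eund v = u"
          using ex1 u eund_Hom[OF vr] v eund_Cmp[OF vr p] eund_Cmp[OF vr q] by metis
        then show "v = EArr z u r" using EArr_eund[OF vr] by simp
      qed
    qed
  }
  {
    assume pb: "is_pullback El p q f g"
    show "is_pullback C (eund p) (eund q) (eund f) (eund g)"
    proof (rule is_pullbackI[OF up uq uf ug])
      show "Cmp C (eund f) (eund p) = Cmp C (eund g) (eund q)"
        using arg_cong[OF is_pullbackD(5)[OF pb], of eund]
        by (simp add: eund_Cmp[OF p f] eund_Cmp[OF q g])
      fix z h k
      assume z: "z \<in> Obj C" and h: "h \<in> Hom C z (eobj s)" and k: "k \<in> Hom C z (eobj t)"
        and eq: "Cmp C (eund f) h = Cmp C (eund g) k"
      let ?e = "Elt z (act P h (eelt s))"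
      have b: "eelt b \<in> Fob P (eobj b)" "act P (eund f) (eelt b) = eelt s"
        "act P (eund g) (eelt b) = eelt t"
        using f g by (auto elim!: Hom_ElE simp: Obj_ElD)
      \<comment> \<open>The two legs of the cone lift to the same tip, as both restrict the element of \<open>b\<close>.\<close>
      have tip: "act P h (eelt s) = act P k (eelt t)"
        using act_Cmp[OF h uf b(1)] act_Cmp[OF k ug b(1)] eq b by simp
      have H: "EArr ?e h s \<in> Hom El ?e s" and K: "EArr ?e k t \<in> Hom El ?e t"
        using elements_lift[OF _ h] elements_lift[OF _ k] Hom_El_Obj[OF f] Hom_El_Obj[OF g]
        by (auto simp: tip)
      have "Cmp El f (EArr ?e h s) = Cmp El g (EArr ?e k t)"
        using Cmp_El[OF H f] Cmp_El[OF K g] eq by simp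
      then have ex1: "\<exists>!u. u \<in> Hom El ?e r \<and> Cmp El p u = EArr ?e h s \<and> Cmp El q u = EArr ?e k t"
        using is_pullback_universal[OF pb] H K Hom_El_Obj[OF H] by (simp add: src)
      then obtain u where u: "u \<in> Hom El ?e r" "Cmp El p u = EArr ?e h s"
        "Cmp El q u = EArr ?e k t" by blast
      show "\<exists>!u. u \<in> Hom C z (eobj r) \<and> Cmp C (eund p) u = h \<and> Cmp C (eund q) u = k"
      proof (rule ex1I[of _ "eund u"])
        show "eund u \<in> Hom C z (eobj r) \<and> Cmp C (eund p) (eund u) = h \<and> Cmp C (eund q) (eund u) = k"
          using eund_Hom[OF u(1)] eund_Cmp[OF u(1) p] eund_Cmp[OF u(1) q] u(2,3) by simp
        fix v assume v: "v \<in> Hom C z (eobj r) \<and> Cmp C (eund p) v = h \<and> Cmp C (eund q) v = k"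
        then have "EArr ?e v r \<in> Hom El ?e r \<and> Cmp El p (EArr ?e v r) = EArr ?e h s
            \<and> Cmp El q (EArr ?e v r) = EArr ?e k t"
          using elements_factor[OF p H, of v] elements_factor[OF q K, of v] by simp
        with ex1 u have "EArr ?e v r = u" by blast
        then show "v = eund u" by auto
      qed
    qed
  }
qed

end


section \<open>The base of the category of elements\<close>

locale based_presheaf = presheaf C P for C :: "'v ucat" and P :: "'v presheaf" +
  fixes B :: "'v ubase"
  assumes base: "base_of_computability C B"
begin

abbreviation BEl :: "'v ubase" where "BEl \<equiv> elements_base C B P"

lemma elements_base_iff:
  assumes e: "e \<in> Obj El"
  shows "i \<in> BEl e \<longleftrightarrow> i \<in> Hom El (Src El i) e \<and> eund i \<in> B (eobj e)"
proof
  assume "i \<in> BEl e"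
  then show "i \<in> Hom El (Src El i) e \<and> eund i \<in> B (eobj e)"
    using e by (auto simp: elements_base_def Hom_iff pr_simps dest: mono_Mor)
next
  assume i: "i \<in> Hom El (Src El i) e \<and> eund i \<in> B (eobj e)"
  then show "i \<in> BEl e"
    using e elements_mono[of i] base_mono[OF base Obj_ElD(2)[OF e]] elements_cartesian[of i]
    by (auto simp: elements_base_def pr_simps) (auto simp: Hom_iff)
qed

lemma base_elements: "base_of_computability El BEl"
  unfolding base_of_computability_def
proof (intro conjI ballI)
  interpret El: category El by (rule category_elements)
  show "BEl \<in> extensional (Obj El)" by (simp add: elements_base_def)
  show "mono_arrow El i" "Tgt El i = a" if "a \<in> Obj El" "i \<in> BEl a" for a i
    using that by (auto simp: elements_base_def)
  show "Idn El a \<in> BEl a" if a: "a \<in> Obj El" for a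
    using El.Idn_Hom[OF a] base_Idn[OF base Obj_ElD(2)[OF a]] a
    by (simp add: elements_base_iff Idn_El) (simp add: Hom_iff)
  fix a b i j f
  assume a: "a \<in> Obj El" and b: "b \<in> Obj El" and "i \<in> BEl a" "j \<in> BEl b"
    and f: "f \<in> Hom El (Src El i) b"
  define s t where "s = Src El i" and "t = Src El j"
  have i: "i \<in> Hom El s a" "eund i \<in> B (eobj a)" and j: "j \<in> Hom El t b" "eund j \<in> B (eobj b)"
    using \<open>i \<in> BEl a\<close> \<open>j \<in> BEl b\<close> a b by (simp_all add: elements_base_iff s_def t_def)
  have f: "f \<in> Hom El s b" using f by (simp add: s_def t_def)
  have "eund f \<in> Hom C (Src C (eund i)) (eobj b)"
    using eund_Hom[OF f] eund_Hom[OF i(1)] by (simp add: Hom_iff)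
  then obtain p q where pb: "is_pullback C p q (eund f) (eund j)"
    and ip: "Cmp C (eund i) p \<in> B (eobj a)"
    using base_pullback[OF base Obj_ElD(2)[OF a] i(2) Obj_ElD(2)[OF b] j(2)] by blast
  define c where "c = Src C p"
  have p: "p \<in> Hom C c (eobj s)" and q: "q \<in> Hom C c (eobj t)"
    using is_pullbackD(1,2)[OF pb] eund_Hom[OF f] eund_Hom[OF j(1)] by (auto simp: Hom_iff c_def)
  let ?r = "Elt c (act P p (eelt s))"
  have eb: "eelt b \<in> Fob P (eobj b)" "act P (eund f) (eelt b) = eelt s"
    "act P (eund j) (eelt b) = eelt t"
    using f j by (auto elim!: Hom_ElE simp: Obj_ElD)
  \<comment> \<open>The pullback in \<open>C\<close> lifts: its two projections restrict the elements of \<open>s\<close> and \<open>t\<close>, which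
    are themselves restrictions of the element of \<open>b\<close>, to the same element.\<close>
  have tip: "act P p (eelt s) = act P q (eelt t)"
    using act_Cmp[OF p eund_Hom[OF f] eb(1)] act_Cmp[OF q eund_Hom[OF j(1)] eb(1)]
      is_pullbackD(5)[OF pb] eb by simp
  have P: "EArr ?r p s \<in> Hom El ?r s" and Q: "EArr ?r q t \<in> Hom El ?r t"
    using elements_lift[OF _ p] elements_lift[OF _ q] Hom_El_Obj[OF f] Hom_El_Obj[OF j(1)]
    by (auto simp: tip)
  have "is_pullback El (EArr ?r p s) (EArr ?r q t) f j"
    using elements_pullback_iff[OF P Q f j(1)] pb by simp
  moreover have "Cmp El i (EArr ?r p s) \<in> BEl a"
    using El.Cmp_Hom[OF P i(1)] eund_Cmp[OF P i(1)] ip a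
    by (simp add: elements_base_iff) (simp add: Hom_iff)
  ultimately show "\<exists>p q. is_pullback El p q f j \<and> Cmp El i p \<in> BEl a" by blast
qed

end

section \<open>Functors into the category of elements\<close>

text \<open>An element of the limit of \<open>P\<close> composed with \<open>H\<close>, that is, a cone over the composite with the
  one-point set as its tip.\<close>

definition compatible_family ::
  "'v presheaf \<Rightarrow> ('o, 'a) cat \<Rightarrow> ('o, 'a, 'v univ, 'v univ) func \<Rightarrow> ('o \<Rightarrow> 'v univ) \<Rightarrow> bool" where
  "compatible_family P Z H x \<longleftrightarrow>
     (\<forall>z \<in> Obj Z. x z \<in> Fob P (Fob H z)) \<and>
     (\<forall>a b. \<forall>u \<in> Hom Z a b. act P (Far H u) (x b) = x a)"

definition elements_functor ::
  "('o, 'a) cat \<Rightarrow> ('o, 'a, 'v univ, 'v univ) func \<Rightarrow> ('o \<Rightarrow> 'v univ) \<Rightarrow>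
     ('o, 'a, 'v univ, 'v univ) func" where
  "elements_functor Z H x =
     (let ob = (\<lambda>z. Elt (Fob H z) (x z))
      in \<lparr>Fob = restrict ob (Obj Z),
          Far = (\<lambda>u\<in>Mor Z. EArr (ob (Src Z u)) (Far H u) (ob (Tgt Z u)))\<rparr>)"

lemma elements_functor_simps:
  "z \<in> Obj Z \<Longrightarrow> Fob (elements_functor Z H x) z = Elt (Fob H z) (x z)"
  "u \<in> Hom Z a b \<Longrightarrow>
     Far (elements_functor Z H x) u = EArr (Elt (Fob H a) (x a)) (Far H u) (Elt (Fob H b) (x b))"
  by (auto simp: elements_functor_def Hom_iff)

text \<open>Compatibility says exactly that \<open>H\<close> sends arrows to arrows between the chosen elements. The
  rest is inherited from \<open>H\<close>, since identities, composites and pullbacks in the category of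
  elements, and membership in its base, are all decided by the underlying arrows.\<close>

lemma (in based_presheaf) elements_functor_transfer:
  assumes "category Z" and BZ: "base_of_computability Z BZ"
    and H: "computability_transfer Z BZ C B H" and x: "compatible_family P Z H x"
  shows "computability_transfer Z BZ El BEl (elements_functor Z H x)"
proof -
  interpret Z: category Z by fact
  interpret El: category El by (rule category_elements)
  note fH = transfer_functor[OF H]
  let ?L = "elements_functor Z H x"
  have ob: "Elt (Fob H z) (x z) \<in> Obj El" if "z \<in> Obj Z" for z
    using that x functor_Fob[OF fH that] by (simp add: Obj_El compatible_family_def)
  have ar: "EArr (Elt (Fob H a) (x a)) (Far H u) (Elt (Fob H b) (x b))
      \<in> Hom El (Elt (Fob H a) (x a)) (Elt (Fob H b) (x b))" if "u \<in> Hom Z a b" for a b u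
    using that ob Z.Hom_Obj[OF that] functor_Far[OF fH that] x
    by (auto simp: EArr_Hom_El compatible_family_def)
  have fL: "is_functor Z El ?L"
  proof (rule is_functorI)
    show "Fob ?L \<in> Obj Z \<rightarrow>\<^sub>E Obj El" "Far ?L \<in> extensional (Mor Z)"
      using ob by (auto simp: elements_functor_def Let_def)
    show "Far ?L u \<in> Hom El (Fob ?L a) (Fob ?L b)" if "u \<in> Hom Z a b" for a b u
      using ar[OF that] Z.Hom_Obj[OF that] by (simp add: elements_functor_simps(1) elements_functor_simps(2)[OF that])
    show "Far ?L (Idn Z a) = Idn El (Fob ?L a)" if "a \<in> Obj Z" for a
      using that ob[OF that] functor_Idn[OF fH that] Z.Idn_Hom[OF that]
      by (simp add: elements_functor_simps Idn_El)
    show "Far ?L (Cmp Z v u) = Cmp El (Far ?L v) (Far ?L u)"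
      if u: "u \<in> Hom Z a b" and v: "v \<in> Hom Z b c" for a b c u v
      using Cmp_El[OF ar[OF u] ar[OF v]] functor_Cmp[OF fH u v] Z.Cmp_Hom[OF u v]
      by (simp add: elements_functor_simps(2)[OF u] elements_functor_simps(2)[OF v]
          elements_functor_simps(2)[OF Z.Cmp_Hom[OF u v]])
  qed
  have und: "eund (Far ?L u) = Far H u" if "u \<in> Hom Z a b" for a b u
    by (simp add: elements_functor_simps(2)[OF that])
  show ?thesis
    unfolding computability_transfer_def
  proof (intro conjI ballI allI impI)
    show "is_functor Z El ?L" by (rule fL)
    fix b j assume b: "b \<in> Obj Z" and j: "j \<in> BZ b"
    note jH = base_Hom[OF BZ b j]
    show "Far ?L j \<in> BEl (Fob ?L b)"
      using transfer_base[OF H b j] functor_Far[OF fL jH] functor_Fob[OF fL b] und[OF jH]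
      by (simp add: elements_base_iff elements_functor_simps b) (simp add: Hom_iff)
    fix f p q assume pb: "is_pullback Z p q f j"
    note D = is_pullbackD(1-4)[OF pb]
    show "is_pullback El (Far ?L p) (Far ?L q) (Far ?L f) (Far ?L j)"
      unfolding elements_pullback_iff[OF D[THEN functor_Far[OF fL]]] D[THEN und]
      using transfer_pullback[OF H b j pb] .
  qed
qed

context presheaf
begin

lemma functor_elements_pr: "is_functor El C (elements_pr C P)"
proof (rule is_functorI)
  interpret El: category El by (rule category_elements)
  show "Fob (elements_pr C P) \<in> Obj El \<rightarrow>\<^sub>E Obj C" "Far (elements_pr C P) \<in> extensional (Mor El)"
    by (auto simp: elements_pr_def Obj_ElD)
  show "Far (elements_pr C P) u \<in> Hom C (Fob (elements_pr C P) a) (Fob (elements_pr C P) b)"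
    if "u \<in> Hom El a b" for a b u
    using that Hom_El_Obj[OF that] eund_Hom[OF that] by (simp add: pr_simps)
  show "Far (elements_pr C P) (Idn El a) = Idn C (Fob (elements_pr C P) a)" if "a \<in> Obj El" for a
    using that El.Idn_Hom[OF that] by (simp add: pr_simps) (simp add: Idn_El)
  show "Far (elements_pr C P) (Cmp El v u) =
      Cmp C (Far (elements_pr C P) v) (Far (elements_pr C P) u)"
    if "u \<in> Hom El a b" "v \<in> Hom El b c" for a b c u v
    using that El.Cmp_Hom[OF that] by (simp add: pr_simps eund_Cmp)
qed

text \<open>Together, the next three facts identify functors into the category of elements with pairs of a
  functor into \<open>C\<close> and a compatible family over it.\<close>

lemma pr_elements_functor:
  assumes "category Z" "is_functor Z C H" "is_functor Z El (elements_functor Z H x)"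
  shows "comp_func Z (elements_pr C P) (elements_functor Z H x) = H"
proof (rule functor_eqI)
  show "is_functor Z C (comp_func Z (elements_pr C P) (elements_functor Z H x))"
    using category.is_functor_comp[OF assms(1,3) functor_elements_pr] .
  show "is_functor Z C H" by fact
  show "Fob (comp_func Z (elements_pr C P) (elements_functor Z H x)) z = Fob H z"
    if "z \<in> Obj Z" for z
    using functor_Fob[OF assms(3) that] that
    by (simp add: comp_func_simps pr_simps elements_functor_simps)
  show "Far (comp_func Z (elements_pr C P) (elements_functor Z H x)) u = Far H u"
    if "u \<in> Mor Z" for u
  proof -
    have u: "u \<in> Hom Z (Src Z u) (Tgt Z u)" using that by (simp add: Hom_iff)
    show ?thesis
      using functor_Far[OF assms(3) u]
      by (simp add: comp_func_simps(3)[OF u] pr_simps(3)) (simp add: elements_functor_simps(2)[OF u])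
  qed
qed

lemma compatible_family_eelt:
  assumes T: "is_functor Z El T" and "category Z"
  shows "compatible_family P Z (comp_func Z (elements_pr C P) T) (\<lambda>z. eelt (Fob T z))"
proof -
  interpret Z: category Z by fact
  have "act P (Far (comp_func Z (elements_pr C P) T) u) (eelt (Fob T b)) = eelt (Fob T a)"
    if "u \<in> Hom Z a b" for a b u
    using functor_Far[OF T that]
    by (auto simp: comp_func_simps(3)[OF that] pr_simps elim!: Hom_ElE)
  then show ?thesis
    using functor_Fob[OF T] by (simp add: compatible_family_def comp_func_simps pr_simps Obj_ElD)
qed

lemma functor_into_elements_eqI:
  assumes S: "is_functor Z El S" and T: "is_functor Z El T" and "category Z"
    and pr: "comp_func Z (elements_pr C P) S = comp_func Z (elements_pr C P) T"
    and elt: "\<And>z. z \<in> Obj Z \<Longrightarrow> eelt (Fob S z) = eelt (Fob T z)"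
  shows "S = T"
proof (rule functor_eqI[OF S T])
  interpret Z: category Z by fact
  show ob: "Fob S z = Fob T z" if z: "z \<in> Obj Z" for z
    using arg_cong[OF pr, of "\<lambda>F. Fob F z"] elt[OF z] z
      functor_Fob[OF S z] functor_Fob[OF T z] Obj_ElD(1)
    by (simp add: comp_func_simps pr_simps) metis
  show "Far S u = Far T u" if "u \<in> Mor Z" for u
  proof (rule elements_faithful)
    have u: "u \<in> Hom Z (Src Z u) (Tgt Z u)" using that by (simp add: Hom_iff)
    show Su: "Far S u \<in> Hom El (Fob S (Src Z u)) (Fob S (Tgt Z u))"
      by (rule functor_Far[OF S u])
    show Tu: "Far T u \<in> Hom El (Fob S (Src Z u)) (Fob S (Tgt Z u))"
      using functor_Far[OF T u] Z.Hom_Obj[OF u] by (simp add: ob)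
    show "eund (Far S u) = eund (Far T u)"
      using arg_cong[OF pr, of "\<lambda>F. Far F u"]
      by (simp add: comp_func_simps(3)[OF u] pr_simps(3)[OF Su] pr_simps(3)[OF Tu])
  qed
qed

end

lemma (in based_presheaf) transfer_elements_pr:
  "computability_transfer El BEl C B (elements_pr C P)"
  unfolding computability_transfer_def
proof (intro conjI ballI allI impI)
  show "is_functor El C (elements_pr C P)" by (rule functor_elements_pr)
  show "Far (elements_pr C P) i \<in> B (Fob (elements_pr C P) e)"
    if "e \<in> Obj El" "i \<in> BEl e" for e i
    using that by (auto simp: elements_base_iff pr_simps)
  show "is_pullback C (Far (elements_pr C P) p) (Far (elements_pr C P) q)
      (Far (elements_pr C P) f) (Far (elements_pr C P) j)"
    if pb: "is_pullback El p q f j" for f j p q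
    using pb elements_pullback_iff[OF is_pullbackD(1-4)[OF pb]] is_pullbackD(1-4)[OF pb]
    by (simp add: pr_simps)
qed

section \<open>The category of categories with a base of computability\<close>

lemma Obj_CatBaseComp: "X \<in> Obj CatBaseComp \<longleftrightarrow>
    category (fst X) \<and> extensional_cat (fst X) \<and> base_of_computability (fst X) (snd X)"
  by (cases X) (simp add: CatBaseComp_def CatBaseComp_Obj_def)

lemma Hom_CatBaseComp: "T \<in> Hom CatBaseComp X Y \<longleftrightarrow> X \<in> Obj CatBaseComp \<and> Y \<in> Obj CatBaseComp \<and>
    (\<exists>F. T = Arr X F Y \<and> computability_transfer (fst X) (snd X) (fst Y) (snd Y) F)"
  by (cases X, cases Y) (auto simp: Hom_iff CatBaseComp_def)

lemma CatBaseComp_simps: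
  "Idn CatBaseComp X = Arr X (id_func (fst X)) X"
  "Cmp CatBaseComp (Arr Y' G Z) (Arr X F Y) = Arr X (comp_func (fst X) G F) Z"
  by (simp_all add: CatBaseComp_def)

lemma Cmp_CatBaseComp:
  "Cmp CatBaseComp G F = Arr (asrc F) (comp_func (fst (asrc F)) (amap G) (amap F)) (atgt G)"
  by (simp add: CatBaseComp_def)

lemma Hom_CatBaseCompE:
  assumes "T \<in> Hom CatBaseComp X Y"
  obtains F where "T = Arr X F Y" "X \<in> Obj CatBaseComp" "Y \<in> Obj CatBaseComp"
    "computability_transfer (fst X) (snd X) (fst Y) (snd Y) F" "is_functor (fst X) (fst Y) F"
    "category (fst X)" "category (fst Y)"
proof -
  obtain F where "T = Arr X F Y" "X \<in> Obj CatBaseComp" "Y \<in> Obj CatBaseComp"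
    "computability_transfer (fst X) (snd X) (fst Y) (snd Y) F"
    using assms unfolding Hom_CatBaseComp by blast
  with that show thesis using transfer_functor Obj_CatBaseComp by blast
qed

lemma category_CatBaseComp: "category (CatBaseComp :: ('v catbase, 'v transfer) cat)"
proof
  let ?K = "CatBaseComp :: ('v catbase, 'v transfer) cat"
  show "Src ?K T \<in> Obj ?K" "Tgt ?K T \<in> Obj ?K" if "T \<in> Mor ?K" for T
    using that by (auto simp: CatBaseComp_def)
  show "Idn ?K X \<in> Hom ?K X X" if X: "X \<in> Obj ?K" for X
    using X category.transfer_id[of "fst X" "snd X"]
    by (auto simp: Hom_CatBaseComp CatBaseComp_simps) (auto simp: Obj_CatBaseComp)
  fix X Y Z W :: "'v catbase" and S T U :: "'v transfer"
  assume S: "S \<in> Hom ?K X Y"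
  then show "Cmp ?K S (Idn ?K X) = S" "Cmp ?K (Idn ?K Y) S = S"
    by (auto elim!: Hom_CatBaseCompE simp: CatBaseComp_simps comp_func_id_left comp_func_id_right)
  assume T: "T \<in> Hom ?K Y Z"
  show "Cmp ?K T S \<in> Hom ?K X Z"
    using S T category.transfer_comp[of "fst X" "snd X" "fst Y" "snd Y" _ "fst Z" "snd Z"]
    by (auto elim!: Hom_CatBaseCompE simp: CatBaseComp_simps Hom_CatBaseComp)
      (auto simp: Obj_CatBaseComp)
  assume U: "U \<in> Hom ?K Z W"
  show "Cmp ?K U (Cmp ?K T S) = Cmp ?K (Cmp ?K U T) S"
    using S T U by (auto elim!: Hom_CatBaseCompE simp: CatBaseComp_simps comp_func_assoc)
qed

interpretation CBC: category "CatBaseComp :: ('v catbase, 'v transfer) cat"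
  by (rule category_CatBaseComp)

lemma Fob_Hom: "T \<in> Hom CatBaseComp X Y \<Longrightarrow> z \<in> Obj (fst X) \<Longrightarrow> Fob (amap T) z \<in> Obj (fst Y)"
  by (auto elim!: Hom_CatBaseCompE intro: functor_Fob)

lemma Fob_Cmp: "T \<in> Hom CatBaseComp X Y \<Longrightarrow> z \<in> Obj (fst X) \<Longrightarrow>
    Fob (amap (Cmp CatBaseComp S T)) z = Fob (amap S) (Fob (amap T) z)"
  by (cases S) (auto elim!: Hom_CatBaseCompE simp: CatBaseComp_simps comp_func_simps)


lemma Fob_Idn: "z \<in> Obj (fst X) \<Longrightarrow> Fob (amap (Idn CatBaseComp X)) z = z"
  by (simp add: CatBaseComp_simps id_func_simps)


section \<open>Family arrows and 2-family arrows\<close>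

lemma Obj_fCat: "P \<in> Obj (fCat_CBC X) \<longleftrightarrow> is_functor (op_cat (fst X)) Sets P"
  by (simp add: fCat_CBC_def functor_cat_simps)

lemma presheaf_fCat: "X \<in> Obj CatBaseComp \<Longrightarrow> P \<in> Obj (fCat_CBC X) \<Longrightarrow>
    based_presheaf (fst X) P (snd X)"
  by (simp add: based_presheaf_def based_presheaf_axioms_def presheaf_def presheaf_axioms_def
      Obj_fCat Obj_CatBaseComp)

lemma category_fCat: "X \<in> Obj CatBaseComp \<Longrightarrow> category (fCat_CBC X)"
  unfolding fCat_CBC_def
  by (intro category_functor_cat category_op category_Sets) (simp add: Obj_CatBaseComp)

lemma fcomp_CBC_Arr: "fcomp_CBC P (Arr X F Y) = comp_func (fst X) P F"
  by (simp add: fcomp_CBC_def comp_func_op)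

lemma op_cat_simps: "Obj (op_cat C) = Obj C" "Mor (op_cat C) = Mor C" "id_func (op_cat C) = id_func C"
  by (simp_all add: op_cat_def id_func_def)

interpretation CBC: fam_category
  "CatBaseComp :: ('v catbase, 'v transfer) cat" "\<lambda>X. Obj (fCat_CBC X)" fcomp_CBC
proof
  let ?K = "CatBaseComp :: ('v catbase, 'v transfer) cat"
  fix X Y Z :: "'v catbase" and P S T
  assume S: "S \<in> Hom ?K X Y"
  {
    assume P: "P \<in> Obj (fCat_CBC Y)"
    obtain F where F: "S = Arr X F Y" "is_functor (fst X) (fst Y) F" "category (fst X)"
      using S by (rule Hom_CatBaseCompE)
    show "fcomp_CBC P S \<in> Obj (fCat_CBC X)"
      using category.is_functor_comp[OF category_op[OF F(3)] is_functor_op[OF F(2)]] P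
      by (simp add: F(1) Obj_fCat fcomp_CBC_Arr comp_func_op)
  }
  assume T: "T \<in> Hom ?K Y Z" and "P \<in> Obj (fCat_CBC Z)"
  with S show "fcomp_CBC P (Cmp ?K T S) = fcomp_CBC (fcomp_CBC P T) S"
    by (auto elim!: Hom_CatBaseCompE simp: CatBaseComp_simps fcomp_CBC_Arr comp_func_assoc)
next
  fix X :: "'v catbase" and P
  assume "X \<in> Obj CatBaseComp" "P \<in> Obj (fCat_CBC X)"
  then show "fcomp_CBC P (Idn CatBaseComp X) = P"
    using comp_func_id_right[of "op_cat (fst X)" Sets P]
    by (simp add: CatBaseComp_simps fcomp_CBC_Arr Obj_fCat comp_func_op op_cat_simps)
qed

lemma Hom_fCatE:
  assumes "\<eta> \<in> Hom (fCat_CBC X) P S"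
  obtains \<alpha> where "\<eta> = Arr P \<alpha> S" "nat_trans (op_cat (fst X)) Sets P S \<alpha>"
    "P \<in> Obj (fCat_CBC X)" "S \<in> Obj (fCat_CBC X)"
  using assms by (auto simp: fCat_CBC_def Hom_functor_cat functor_cat_simps)

lemma whisker_CBC_Arr: "whisker_CBC (Arr P \<alpha> S) (Arr X F Y) =
    Arr (fcomp_CBC P (Arr X F Y)) (compose (Obj (fst X)) \<alpha> (Fob F)) (fcomp_CBC S (Arr X F Y))"
  by (simp add: whisker_CBC_def)

interpretation CBC: two_fam_category
  "CatBaseComp :: ('v catbase, 'v transfer) cat" fCat_CBC fcomp_CBC whisker_CBC
proof (rule two_fam_category.intro[OF CBC.fam_category_axioms two_fam_category_axioms.intro])
  let ?K = "CatBaseComp :: ('v catbase, 'v transfer) cat"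
  show "category (fCat_CBC X)" if "X \<in> Obj ?K" for X
    using that by (rule category_fCat)
  show "whisker_CBC \<eta> (Idn ?K X) = \<eta>"
    if X: "X \<in> Obj ?K" and \<eta>: "\<eta> \<in> Hom (fCat_CBC X) P S" for X \<eta> P S
  proof -
    obtain \<alpha> where \<alpha>: "\<eta> = Arr P \<alpha> S" "nat_trans (op_cat (fst X)) Sets P S \<alpha>"
      "P \<in> Obj (fCat_CBC X)" "S \<in> Obj (fCat_CBC X)" using \<eta> by (rule Hom_fCatE)
    have "compose (Obj (fst X)) \<alpha> (Fob (id_func (fst X))) = \<alpha>"
      using nat_trans_ext[OF \<alpha>(2)]
      by (auto intro!: extensionalityI[where A = "Obj (fst X)"] simp: op_cat_simps compose_def id_func_simps)
    then show ?thesis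
      using CBC.fcomp_Idn[OF X \<alpha>(3)] CBC.fcomp_Idn[OF X \<alpha>(4)]
      by (simp add: \<alpha>(1) CatBaseComp_simps whisker_CBC_Arr)
  qed
  fix X Y Z :: "'v catbase" and S T :: "'v transfer" and P Q R \<eta> \<theta>
  assume S: "S \<in> Hom ?K X Y"
  obtain F where F: "S = Arr X F Y" "is_functor (fst X) (fst Y) F" "category (fst X)"
    using S by (rule Hom_CatBaseCompE)
  {
    assume \<eta>: "\<eta> \<in> Hom (fCat_CBC Y) P Q"
    obtain \<alpha> where \<alpha>: "\<eta> = Arr P \<alpha> Q" "nat_trans (op_cat (fst Y)) Sets P Q \<alpha>"
      "P \<in> Obj (fCat_CBC Y)" "Q \<in> Obj (fCat_CBC Y)" using \<eta> by (rule Hom_fCatE)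
    show "whisker_CBC \<eta> S \<in> Hom (fCat_CBC X) (fcomp_CBC P S) (fcomp_CBC Q S)"
      using nat_trans_whisker[OF category_op[OF F(3)] is_functor_op[OF F(2)] \<alpha>(2)]
        CBC.fcomp_fHom[OF S \<alpha>(3)] CBC.fcomp_fHom[OF S \<alpha>(4)]
      by (simp add: \<alpha>(1) F(1) fCat_CBC_def functor_cat_simps Hom_functor_cat whisker_CBC_Arr
          fcomp_CBC_Arr comp_func_op op_cat_simps)
    assume "\<theta> \<in> Hom (fCat_CBC Y) Q R"
    then obtain \<beta> where \<beta>: "\<theta> = Arr Q \<beta> R" by (rule Hom_fCatE)
    show "whisker_CBC (Cmp (fCat_CBC Y) \<theta> \<eta>) S
        = Cmp (fCat_CBC X) (whisker_CBC \<theta> S) (whisker_CBC \<eta> S)"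
      using functor_Fob[OF F(2)]
      by (auto simp: \<alpha>(1) \<beta> F(1) fCat_CBC_def functor_cat_simps whisker_CBC_Arr op_cat_simps
          compose_def intro!: restrict_ext)
  }
  assume T: "T \<in> Hom ?K Y Z" and \<eta>: "\<eta> \<in> Hom (fCat_CBC Z) P Q"
  obtain G where G: "T = Arr Y G Z" using T by (rule Hom_CatBaseCompE)
  obtain \<alpha> where \<alpha>: "\<eta> = Arr P \<alpha> Q" "P \<in> Obj (fCat_CBC Z)" "Q \<in> Obj (fCat_CBC Z)"
    using \<eta> by (rule Hom_fCatE)
  show "whisker_CBC \<eta> (Cmp ?K T S) = whisker_CBC (whisker_CBC \<eta> T) S"
    using functor_Fob[OF F(2)] CBC.fcomp_Cmp[OF S T \<alpha>(2)] CBC.fcomp_Cmp[OF S T \<alpha>(3)]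
    by (auto simp: \<alpha>(1) F(1) G whisker_CBC_Arr CatBaseComp_simps comp_func_def compose_def
        intro!: restrict_ext)
qed

abbreviation component :: "'v presheaf_arr \<Rightarrow> 'v univ \<Rightarrow> 'v univ \<Rightarrow> 'v univ" where
  "component \<eta> c x \<equiv> amap (amap \<eta> c) x"

lemma component_mem:
  assumes "\<eta> \<in> Hom (fCat_CBC X) P S" "c \<in> Obj (fst X)" "x \<in> Fob P c"
  shows "component \<eta> c x \<in> Fob S c"
proof -
  obtain \<alpha> where \<alpha>: "\<eta> = Arr P \<alpha> S" "nat_trans (op_cat (fst X)) Sets P S \<alpha>"
    using assms(1) by (rule Hom_fCatE)
  show ?thesis
    using nat_trans_Hom[OF \<alpha>(2), of c] assms(2,3) by (auto simp: \<alpha>(1) op_cat_simps Hom_Sets)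
qed

lemma component_natural:
  assumes X: "X \<in> Obj CatBaseComp" and \<eta>: "\<eta> \<in> Hom (fCat_CBC X) P S"
    and f: "f \<in> Hom (fst X) c d" and y: "y \<in> Fob P d"
  shows "act S f (component \<eta> d y) = component \<eta> c (act P f y)"
proof -
  obtain \<alpha> where \<alpha>: "\<eta> = Arr P \<alpha> S" "nat_trans (op_cat (fst X)) Sets P S \<alpha>"
    "P \<in> Obj (fCat_CBC X)" "S \<in> Obj (fCat_CBC X)" using \<eta> by (rule Hom_fCatE)
  interpret P: based_presheaf "fst X" P "snd X" using X \<alpha>(3) by (rule presheaf_fCat)
  interpret S: based_presheaf "fst X" S "snd X" using X \<alpha>(4) by (rule presheaf_fCat)
  show ?thesis
    using nat_trans_square[OF \<alpha>(2), of f d c] f y P.Far_Hom[OF f] S.Far_Hom[OF f]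
      nat_trans_Hom[OF \<alpha>(2), of c] nat_trans_Hom[OF \<alpha>(2), of d] P.Hom_Obj[OF f]
    by (auto simp: \<alpha>(1) op_cat_simps Hom_Sets P.Hom_op)
      (auto simp: Sets_def compose_def dest: fun_cong[of _ _ y])
qed

section \<open>Sums\<close>

lemma Sum_CBC_simps: "fst (Sum_CBC X P) = elements (fst X) P"
  "snd (Sum_CBC X P) = elements_base (fst X) (snd X) P"
  by (simp_all add: Sum_CBC_def)

lemma Sum_CBC_Obj:
  assumes "X \<in> Obj CatBaseComp" "P \<in> Obj (fCat_CBC X)"
  shows "Sum_CBC X P \<in> Obj CatBaseComp"
proof -
  interpret based_presheaf "fst X" P "snd X" using assms by (rule presheaf_fCat)
  show ?thesis
    by (simp add: Obj_CatBaseComp Sum_CBC_simps category_elements extensional_elements base_elements)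
qed

lemma pr_CBC_Hom:
  assumes "X \<in> Obj CatBaseComp" "P \<in> Obj (fCat_CBC X)"
  shows "pr_CBC X P \<in> Hom CatBaseComp (Sum_CBC X P) X"
proof -
  interpret based_presheaf "fst X" P "snd X" using assms by (rule presheaf_fCat)
  show ?thesis
    using assms Sum_CBC_Obj[OF assms] transfer_elements_pr
    by (simp add: Hom_CatBaseComp pr_CBC_def Sum_CBC_simps)
qed

lemma Fob_pr_CBC: "e \<in> Obj (elements (fst X) P) \<Longrightarrow> Fob (amap (pr_CBC X P)) e = eobj e"
  by (simp add: pr_CBC_def elements_pr_def)

definition pair_CBC ::
  "'v catbase \<Rightarrow> 'v presheaf \<Rightarrow> 'v transfer \<Rightarrow> ('v univ \<Rightarrow> 'v univ) \<Rightarrow> 'v transfer" where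
  "pair_CBC X P T x =
     Arr (asrc T) (elements_functor (fst (asrc T)) (amap T) x) (Sum_CBC X P)"

text \<open>The sum represents pairs of a transfer into the base and a compatible family over it: such a
  pair induces a transfer into the sum, which is determined by its first projection and by the
  elements that it picks. Existence and uniqueness reduce every axiom about sums to an equation
  between first projections and one between elements.\<close>

lemma pair_CBC:
  assumes X: "X \<in> Obj CatBaseComp" and P: "P \<in> Obj (fCat_CBC X)"
    and T: "T \<in> Hom CatBaseComp Z X" and x: "compatible_family P (fst Z) (amap T) x"
  shows "pair_CBC X P T x \<in> Hom CatBaseComp Z (Sum_CBC X P)"
    and "Cmp CatBaseComp (pr_CBC X P) (pair_CBC X P T x) = T"
    and "z \<in> Obj (fst Z) \<Longrightarrow> eelt (Fob (amap (pair_CBC X P T x)) z) = x z"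
proof -
  interpret based_presheaf "fst X" P "snd X" using X P by (rule presheaf_fCat)
  obtain F where F: "T = Arr Z F X" "Z \<in> Obj CatBaseComp"
      "computability_transfer (fst Z) (snd Z) (fst X) (snd X) F"
      "is_functor (fst Z) (fst X) F" "category (fst Z)"
    using T by (rule Hom_CatBaseCompE)
  have L: "computability_transfer (fst Z) (snd Z) El BEl (elements_functor (fst Z) F x)"
    using F x by (intro elements_functor_transfer) (auto simp: Obj_CatBaseComp)
  show "pair_CBC X P T x \<in> Hom CatBaseComp Z (Sum_CBC X P)"
    using L F(2) Sum_CBC_Obj[OF X P] by (simp add: F(1) pair_CBC_def Hom_CatBaseComp Sum_CBC_simps)
  show "Cmp CatBaseComp (pr_CBC X P) (pair_CBC X P T x) = T"
    using pr_elements_functor[OF F(5,4) transfer_functor[OF L]]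
    by (simp add: F(1) pair_CBC_def pr_CBC_def CatBaseComp_simps)
  show "eelt (Fob (amap (pair_CBC X P T x)) z) = x z" if "z \<in> Obj (fst Z)"
    using that by (simp add: F(1) pair_CBC_def elements_functor_simps)
qed

lemma Sum_CBC_eqI:
  assumes X: "X \<in> Obj CatBaseComp" and P: "P \<in> Obj (fCat_CBC X)"
    and S: "S \<in> Hom CatBaseComp Z (Sum_CBC X P)" and T: "T \<in> Hom CatBaseComp Z (Sum_CBC X P)"
    and pr: "Cmp CatBaseComp (pr_CBC X P) S = Cmp CatBaseComp (pr_CBC X P) T"
    and elt: "\<And>z. z \<in> Obj (fst Z) \<Longrightarrow> eelt (Fob (amap S) z) = eelt (Fob (amap T) z)"
  shows "S = T"
proof -
  interpret based_presheaf "fst X" P "snd X" using X P by (rule presheaf_fCat)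
  obtain F where F: "S = Arr Z F (Sum_CBC X P)" "is_functor (fst Z) (fst (Sum_CBC X P)) F"
      "category (fst Z)"
    using S by (rule Hom_CatBaseCompE)
  obtain G where G: "T = Arr Z G (Sum_CBC X P)" "is_functor (fst Z) (fst (Sum_CBC X P)) G"
    using T by (rule Hom_CatBaseCompE)
  have "F = G"
    using functor_into_elements_eqI[OF F(2)[unfolded Sum_CBC_simps] G(2)[unfolded Sum_CBC_simps] F(3)]
      pr elt by (simp add: F(1) G(1) pr_CBC_def CatBaseComp_simps)
  then show ?thesis by (simp add: F(1) G(1))
qed

text \<open>This equivalence is the pullback property of the squares of \<open>Sig_CBC\<close> in disguise: both sides
  classify transfers into sums, by the universal property above.\<close>

lemma compatible_family_fcomp:
  assumes F: "F \<in> Hom CatBaseComp Y X" and H: "H \<in> Hom CatBaseComp Z Y"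
  shows "compatible_family (fcomp_CBC P F) (fst Z) (amap H) x \<longleftrightarrow>
    compatible_family P (fst Z) (amap (Cmp CatBaseComp F H)) x"
proof -
  obtain f where f: "F = Arr Y f X" using F by (rule Hom_CatBaseCompE)
  obtain h where h: "H = Arr Z h Y" "is_functor (fst Z) (fst Y) h"
    using H by (rule Hom_CatBaseCompE)
  have far: "Far (comp_func (fst Y) P f) (Far h u) = Far P (Far f (Far h u))"
    if "u \<in> Mor (fst Z)" for u
    using comp_func_simps(3)[OF functor_Far[OF h(2)]] that by (simp add: Hom_iff)
  show ?thesis
    using functor_Fob[OF h(2)] far
    by (simp add: f h(1) CatBaseComp_simps fcomp_CBC_Arr compatible_family_def comp_func_simps Hom_iff)
qed

lemma compatible_family_Sum:
  assumes X: "X \<in> Obj CatBaseComp" and P: "P \<in> Obj (fCat_CBC X)"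
    and T: "T \<in> Hom CatBaseComp Z (Sum_CBC X P)"
  shows "compatible_family P (fst Z) (amap (Cmp CatBaseComp (pr_CBC X P) T)) (\<lambda>z. eelt (Fob (amap T) z))"
proof -
  interpret based_presheaf "fst X" P "snd X" using X P by (rule presheaf_fCat)
  obtain F where F: "T = Arr Z F (Sum_CBC X P)" "is_functor (fst Z) (fst (Sum_CBC X P)) F"
      "category (fst Z)"
    using T by (rule Hom_CatBaseCompE)
  show ?thesis
    using compatible_family_eelt[OF F(2)[unfolded Sum_CBC_simps] F(3)]
    by (simp add: F(1) pr_CBC_def CatBaseComp_simps)
qed

lemma compatible_family_pr:
  assumes X: "X \<in> Obj CatBaseComp" and P: "P \<in> Obj (fCat_CBC X)"
  shows "compatible_family P (fst (Sum_CBC X P)) (amap (pr_CBC X P)) eelt"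
proof -
  interpret based_presheaf "fst X" P "snd X" using X P by (rule presheaf_fCat)
  show ?thesis
    by (auto simp: compatible_family_def Sum_CBC_simps pr_CBC_def pr_simps Obj_ElD elim!: Hom_ElE)
qed

lemma Sig_CBC_eq:
  assumes F: "F \<in> Hom CatBaseComp Y X" and P: "P \<in> Obj (fCat_CBC X)"
  shows "Sig_CBC P F = pair_CBC X P (Cmp CatBaseComp F (pr_CBC Y (fcomp_CBC P F))) eelt"
proof -
  have f: "asrc F = Y" "atgt F = X" "Y \<in> Obj CatBaseComp" using F by (auto elim: Hom_CatBaseCompE)
  let ?Q = "fcomp_CBC P F"
  interpret based_presheaf "fst Y" ?Q "snd Y"
    using f(3) CBC.fcomp_fHom[OF F P] by (rule presheaf_fCat)
  show ?thesis
    by (auto simp: Sig_CBC_def Let_def pair_CBC_def pr_CBC_def f(1,2) Cmp_CatBaseComp Sum_CBC_simps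
        elements_functor_def comp_func_simps pr_simps Mor_El_ends intro!: restrict_ext)
qed

lemma Sum2_CBC_eq:
  assumes X: "X \<in> Obj CatBaseComp" and \<eta>: "\<eta> \<in> Hom (fCat_CBC X) P S"
  shows "Sum2_CBC X P S \<eta> = pair_CBC X S (pr_CBC X P) (\<lambda>e. component \<eta> (eobj e) (eelt e))"
proof -
  have P: "P \<in> Obj (fCat_CBC X)" using \<eta> by (rule Hom_fCatE)
  interpret based_presheaf "fst X" P "snd X" using X P by (rule presheaf_fCat)
  show ?thesis
    by (auto simp: Sum2_CBC_def Let_def pair_CBC_def pr_CBC_def Sum_CBC_simps elements_functor_def
        pr_simps Mor_El_ends intro!: restrict_ext)
qed

lemma Sig_CBC:
  assumes F: "F \<in> Hom CatBaseComp Y X" and P: "P \<in> Obj (fCat_CBC X)"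
  shows "Sig_CBC P F \<in> Hom CatBaseComp (Sum_CBC Y (fcomp_CBC P F)) (Sum_CBC X P)"
    and "Cmp CatBaseComp (pr_CBC X P) (Sig_CBC P F) =
      Cmp CatBaseComp F (pr_CBC Y (fcomp_CBC P F))"
    and "e \<in> Obj (elements (fst Y) (fcomp_CBC P F)) \<Longrightarrow> eelt (Fob (amap (Sig_CBC P F)) e) = eelt e"
proof -
  have Y: "Y \<in> Obj CatBaseComp" and X: "X \<in> Obj CatBaseComp" using CBC.Hom_Obj[OF F] by auto
  note Q = CBC.fcomp_fHom[OF F P]
  note pr = pr_CBC_Hom[OF Y Q]
  note pair = pair_CBC[OF X P CBC.Cmp_Hom[OF pr F]
      compatible_family_fcomp[OF F pr, THEN iffD1, OF compatible_family_pr[OF Y Q]],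
      folded Sig_CBC_eq[OF F P]]
  show "Sig_CBC P F \<in> Hom CatBaseComp (Sum_CBC Y (fcomp_CBC P F)) (Sum_CBC X P)"
    "Cmp CatBaseComp (pr_CBC X P) (Sig_CBC P F) = Cmp CatBaseComp F (pr_CBC Y (fcomp_CBC P F))"
    by (rule pair)+
  show "e \<in> Obj (elements (fst Y) (fcomp_CBC P F)) \<Longrightarrow> eelt (Fob (amap (Sig_CBC P F)) e) = eelt e"
    using pair(3) by (simp add: Sum_CBC_simps)
qed

text \<open>Naturality of \<open>\<eta>\<close> is what makes the image of the tautological family compatible.\<close>

lemma Sum2_CBC:
  assumes X: "X \<in> Obj CatBaseComp" and \<eta>: "\<eta> \<in> Hom (fCat_CBC X) P S"
  shows "Sum2_CBC X P S \<eta> \<in> Hom CatBaseComp (Sum_CBC X P) (Sum_CBC X S)"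
    and "Cmp CatBaseComp (pr_CBC X S) (Sum2_CBC X P S \<eta>) = pr_CBC X P"
    and "e \<in> Obj (elements (fst X) P) \<Longrightarrow>
      eelt (Fob (amap (Sum2_CBC X P S \<eta>)) e) = component \<eta> (eobj e) (eelt e)"
proof -
  have P: "P \<in> Obj (fCat_CBC X)" and S: "S \<in> Obj (fCat_CBC X)" using \<eta> by (auto elim: Hom_fCatE)
  interpret based_presheaf "fst X" P "snd X" using X P by (rule presheaf_fCat)
  have "compatible_family S (fst (Sum_CBC X P)) (amap (pr_CBC X P))
      (\<lambda>e. component \<eta> (eobj e) (eelt e))"
    unfolding compatible_family_def Sum_CBC_simps
  proof (intro conjI ballI allI)
    show "component \<eta> (eobj e) (eelt e) \<in> Fob S (Fob (amap (pr_CBC X P)) e)" if "e \<in> Obj El" for e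
      using component_mem[OF \<eta>] Obj_ElD[OF that] that by (simp add: pr_CBC_def pr_simps)
    show "act S (Far (amap (pr_CBC X P)) u) (component \<eta> (eobj b) (eelt b))
        = component \<eta> (eobj a) (eelt a)" if u: "u \<in> Hom El a b" for a b u
      using component_natural[OF X \<eta> eund_Hom[OF u], of "eelt b"] u
      by (auto simp: pr_CBC_def pr_simps(3)[OF u] Obj_ElD elim!: Hom_ElE)
  qed
  note pair = pair_CBC[OF X S pr_CBC_Hom[OF X P] this, folded Sum2_CBC_eq[OF X \<eta>]]
  show "Sum2_CBC X P S \<eta> \<in> Hom CatBaseComp (Sum_CBC X P) (Sum_CBC X S)"
    "Cmp CatBaseComp (pr_CBC X S) (Sum2_CBC X P S \<eta>) = pr_CBC X P"
    by (rule pair)+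
  show "e \<in> Obj (elements (fst X) P) \<Longrightarrow>
      eelt (Fob (amap (Sum2_CBC X P S \<eta>)) e) = component \<eta> (eobj e) (eelt e)"
    using pair(3) by (simp add: Sum_CBC_simps)
qed

lemma eobj_Fob:
  assumes X: "X \<in> Obj CatBaseComp" and P: "P \<in> Obj (fCat_CBC X)"
    and T: "T \<in> Hom CatBaseComp Z (Sum_CBC X P)" and z: "z \<in> Obj (fst Z)"
  shows "eobj (Fob (amap T) z) = Fob (amap (Cmp CatBaseComp (pr_CBC X P) T)) z"
  using Fob_Cmp[OF T z] Fob_Hom[OF T z] by (simp add: Fob_pr_CBC Sum_CBC_simps)

lemma Sig_CBC_pullback:
  assumes F: "F \<in> Hom CatBaseComp Y X" and P: "P \<in> Obj (fCat_CBC X)"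
  shows "is_pullback CatBaseComp (pr_CBC Y (fcomp_CBC P F)) (Sig_CBC P F) F (pr_CBC X P)"
proof -
  let ?K = "CatBaseComp" and ?Q = "fcomp_CBC P F"
  have Y: "Y \<in> Obj ?K" and X: "X \<in> Obj ?K" using CBC.Hom_Obj[OF F] by auto
  note Q = CBC.fcomp_fHom[OF F P]
  note prX = pr_CBC_Hom[OF X P] and prY = pr_CBC_Hom[OF Y Q] and Sig = Sig_CBC[OF F P]
  show ?thesis
  proof (rule is_pullbackI[OF prY Sig(1) F prX Sig(2)[symmetric]])
    fix Z H T
    assume H: "H \<in> Hom ?K Z Y" and T: "T \<in> Hom ?K Z (Sum_CBC X P)"
      and eq: "Cmp ?K F H = Cmp ?K (pr_CBC X P) T"
    let ?x = "\<lambda>z. eelt (Fob (amap T) z)"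
    let ?U = "pair_CBC Y ?Q H ?x"
    have "compatible_family ?Q (fst Z) (amap H) ?x"
      using compatible_family_fcomp[OF F H] compatible_family_Sum[OF X P T] by (simp add: eq)
    note U = pair_CBC[OF Y Q H this]
    have Sig_elt: "eelt (Fob (amap (Cmp ?K (Sig_CBC P F) V)) z) = eelt (Fob (amap V) z)"
      if "V \<in> Hom ?K Z (Sum_CBC Y ?Q)" "z \<in> Obj (fst Z)" for V z
      using Fob_Hom[OF that] by (simp add: Fob_Cmp[OF that] Sig(3) Sum_CBC_simps)
    show "\<exists>!V. V \<in> Hom ?K Z (Sum_CBC Y ?Q) \<and> Cmp ?K (pr_CBC Y ?Q) V = H \<and> Cmp ?K (Sig_CBC P F) V = T"
    proof (rule ex1I[of _ ?U], intro conjI)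
      show "?U \<in> Hom ?K Z (Sum_CBC Y ?Q)" "Cmp ?K (pr_CBC Y ?Q) ?U = H" by (rule U)+
      show "Cmp ?K (Sig_CBC P F) ?U = T"
      proof (rule Sum_CBC_eqI[OF X P CBC.Cmp_Hom[OF U(1) Sig(1)] T])
        show "Cmp ?K (pr_CBC X P) (Cmp ?K (Sig_CBC P F) ?U) = Cmp ?K (pr_CBC X P) T"
          using CBC.Cmp_assoc[OF U(1) Sig(1) prX] CBC.Cmp_assoc[OF U(1) prY F]
          by (simp add: Sig(2) U(2) eq)
      qed (simp add: Sig_elt[OF U(1)] U(3))
      fix V assume V: "V \<in> Hom ?K Z (Sum_CBC Y ?Q) \<and> Cmp ?K (pr_CBC Y ?Q) V = H
        \<and> Cmp ?K (Sig_CBC P F) V = T"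
      show "V = ?U"
      proof (rule Sum_CBC_eqI[OF Y Q _ U(1)])
        show "V \<in> Hom ?K Z (Sum_CBC Y ?Q)" "Cmp ?K (pr_CBC Y ?Q) V = Cmp ?K (pr_CBC Y ?Q) ?U"
          using V by (simp_all add: U(2))
        show "eelt (Fob (amap V) z) = eelt (Fob (amap ?U) z)" if "z \<in> Obj (fst Z)" for z
          using Sig_elt[of V z] V that by (simp add: U(3))
      qed
    qed
  qed
qed

interpretation CBC: fam_Sigma_category
  "CatBaseComp :: ('v catbase, 'v transfer) cat" "\<lambda>X. Obj (fCat_CBC X)" fcomp_CBC
  Sum_CBC pr_CBC Sig_CBC
proof
  let ?K = "CatBaseComp :: ('v catbase, 'v transfer) cat"
  show "Sum_CBC X P \<in> Obj ?K" "pr_CBC X P \<in> Hom ?K (Sum_CBC X P) X"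
    if "X \<in> Obj ?K" "P \<in> Obj (fCat_CBC X)" for X P
    using that by (rule Sum_CBC_Obj pr_CBC_Hom)+
  show "Sig_CBC P F \<in> Hom ?K (Sum_CBC Y (fcomp_CBC P F)) (Sum_CBC X P)"
    "is_pullback ?K (pr_CBC Y (fcomp_CBC P F)) (Sig_CBC P F) F (pr_CBC X P)"
    if "F \<in> Hom ?K Y X" "P \<in> Obj (fCat_CBC X)" for F X Y P
    using that by (rule Sig_CBC(1) Sig_CBC_pullback)+
  show "Sig_CBC P (Idn ?K X) = Idn ?K (Sum_CBC X P)"
    if X: "X \<in> Obj ?K" and P: "P \<in> Obj (fCat_CBC X)" for X P
  proof (rule Sum_CBC_eqI[OF X P _ CBC.Idn_Hom[OF Sum_CBC_Obj[OF X P]]])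
    note Sig = Sig_CBC[OF CBC.Idn_Hom[OF X] P, unfolded CBC.fcomp_Idn[OF X P]]
    show "Sig_CBC P (Idn ?K X) \<in> Hom ?K (Sum_CBC X P) (Sum_CBC X P)" by (rule Sig)
    show "Cmp ?K (pr_CBC X P) (Sig_CBC P (Idn ?K X))
        = Cmp ?K (pr_CBC X P) (Idn ?K (Sum_CBC X P))"
      using CBC.Idn_left[OF pr_CBC_Hom[OF X P]] CBC.Idn_right[OF pr_CBC_Hom[OF X P]]
      by (simp add: Sig(2))
    show "eelt (Fob (amap (Sig_CBC P (Idn ?K X))) z)
        = eelt (Fob (amap (Idn ?K (Sum_CBC X P))) z)" if "z \<in> Obj (fst (Sum_CBC X P))" for z
      using that by (simp add: Sum_CBC_simps Sig(3) Fob_Idn)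
  qed
  show "Sig_CBC P (Cmp ?K F G) = Cmp ?K (Sig_CBC P F) (Sig_CBC (fcomp_CBC P F) G)"
    if G: "G \<in> Hom ?K Z Y" and F: "F \<in> Hom ?K Y X" and P: "P \<in> Obj (fCat_CBC X)" for F G X Y Z P
  proof -
    have X: "X \<in> Obj ?K" and Y: "Y \<in> Obj ?K" and Z: "Z \<in> Obj ?K"
      using CBC.Hom_Obj[OF F] CBC.Hom_Obj[OF G] by auto
    note Q = CBC.fcomp_fHom[OF F P] and FG = CBC.Cmp_Hom[OF G F]
    note SF = Sig_CBC[OF F P] and SG = Sig_CBC[OF G Q]
      and SFG = Sig_CBC[OF FG P, unfolded CBC.fcomp_Cmp[OF G F P]]
    show ?thesis
    proof (rule Sum_CBC_eqI[OF X P SFG(1) CBC.Cmp_Hom[OF SG(1) SF(1)]])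
      show "Cmp ?K (pr_CBC X P) (Sig_CBC P (Cmp ?K F G))
          = Cmp ?K (pr_CBC X P) (Cmp ?K (Sig_CBC P F) (Sig_CBC (fcomp_CBC P F) G))"
        using CBC.Cmp_assoc[OF SG(1) SF(1) pr_CBC_Hom[OF X P]]
          CBC.Cmp_assoc[OF SG(1) pr_CBC_Hom[OF Y Q] F]
          CBC.Cmp_assoc[OF pr_CBC_Hom[OF Z CBC.fcomp_fHom[OF G Q]] G F]
        by (simp add: SFG(2) SF(2) SG(2))
      fix z assume z: "z \<in> Obj (fst (Sum_CBC Z (fcomp_CBC (fcomp_CBC P F) G)))"
      show "eelt (Fob (amap (Sig_CBC P (Cmp ?K F G))) z)
          = eelt (Fob (amap (Cmp ?K (Sig_CBC P F) (Sig_CBC (fcomp_CBC P F) G))) z)"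
        using z Fob_Hom[OF SG(1) z] Fob_Cmp[OF SG(1) z]
        by (simp add: Sum_CBC_simps SFG(3) SF(3) SG(3))
    qed
  qed
qed

lemma Sum2_CBC_Idn:
  assumes X: "X \<in> Obj CatBaseComp" and P: "P \<in> Obj (fCat_CBC X)"
  shows "Sum2_CBC X P P (Idn (fCat_CBC X) P) = Idn CatBaseComp (Sum_CBC X P)"
proof -
  interpret based_presheaf "fst X" P "snd X" using X P by (rule presheaf_fCat)
  note S2 = Sum2_CBC[OF X category.Idn_Hom[OF category_fCat[OF X] P]]
  show ?thesis
  proof (rule Sum_CBC_eqI[OF X P S2(1) CBC.Idn_Hom[OF Sum_CBC_Obj[OF X P]]])
    show "Cmp CatBaseComp (pr_CBC X P) (Sum2_CBC X P P (Idn (fCat_CBC X) P))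
        = Cmp CatBaseComp (pr_CBC X P) (Idn CatBaseComp (Sum_CBC X P))"
      using CBC.Idn_right[OF pr_CBC_Hom[OF X P]] by (simp add: S2(2))
    show "eelt (Fob (amap (Sum2_CBC X P P (Idn (fCat_CBC X) P))) z)
        = eelt (Fob (amap (Idn CatBaseComp (Sum_CBC X P))) z)" if "z \<in> Obj (fst (Sum_CBC X P))" for z
      using that S2(3)[of z] Obj_ElD[of z]
      by (simp add: Sum_CBC_simps CatBaseComp_simps id_func_simps fCat_CBC_def
          functor_cat_simps op_cat_simps Sets_def)
  qed
qed

lemma Sum2_CBC_Cmp:
  assumes X: "X \<in> Obj CatBaseComp" and \<theta>: "\<theta> \<in> Hom (fCat_CBC X) R P"
    and \<eta>: "\<eta> \<in> Hom (fCat_CBC X) P S"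
  shows "Cmp CatBaseComp (Sum2_CBC X P S \<eta>) (Sum2_CBC X R P \<theta>) =
    Sum2_CBC X R S (Cmp (fCat_CBC X) \<eta> \<theta>)"
proof -
  have P: "P \<in> Obj (fCat_CBC X)" and S: "S \<in> Obj (fCat_CBC X)" using \<eta> by (auto elim: Hom_fCatE)
  have R: "R \<in> Obj (fCat_CBC X)" using \<theta> by (rule Hom_fCatE)
  interpret based_presheaf "fst X" R "snd X" using X R by (rule presheaf_fCat)
  note S\<eta> = Sum2_CBC[OF X \<eta>]
  note S\<theta> = Sum2_CBC[OF X \<theta>]
    and S\<eta>\<theta> = Sum2_CBC[OF X category.Cmp_Hom[OF category_fCat[OF X] \<theta> \<eta>]]
  obtain \<alpha> where \<alpha>: "\<eta> = Arr P \<alpha> S" "nat_trans (op_cat (fst X)) Sets P S \<alpha>"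
    using \<eta> by (rule Hom_fCatE)
  obtain \<beta> where \<beta>: "\<theta> = Arr R \<beta> P" "nat_trans (op_cat (fst X)) Sets R P \<beta>"
    using \<theta> by (rule Hom_fCatE)
  have comp: "component (Cmp (fCat_CBC X) \<eta> \<theta>) c x = component \<eta> c (component \<theta> c x)"
    if "c \<in> Obj (fst X)" "x \<in> Fob R c" for c x
    using that nat_trans_Hom[OF \<beta>(2), of c]
    by (auto simp: \<alpha>(1) \<beta>(1) fCat_CBC_def functor_cat_simps op_cat_simps Hom_Sets)
      (auto simp: Sets_def compose_def)
  show ?thesis
  proof (rule Sum_CBC_eqI[OF X S CBC.Cmp_Hom[OF S\<theta>(1) S\<eta>(1)] S\<eta>\<theta>(1)])
    show "Cmp CatBaseComp (pr_CBC X S) (Cmp CatBaseComp (Sum2_CBC X P S \<eta>) (Sum2_CBC X R P \<theta>))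
        = Cmp CatBaseComp (pr_CBC X S) (Sum2_CBC X R S (Cmp (fCat_CBC X) \<eta> \<theta>))"
      using CBC.Cmp_assoc[OF S\<theta>(1) S\<eta>(1) pr_CBC_Hom[OF X S]] by (simp add: S\<eta>(2) S\<theta>(2) S\<eta>\<theta>(2))
    fix z assume z: "z \<in> Obj (fst (Sum_CBC X R))"
    then have z': "z \<in> Obj El" by (simp add: Sum_CBC_simps)
    have "eobj (Fob (amap (Sum2_CBC X R P \<theta>)) z) = eobj z"
      using eobj_Fob[OF X P S\<theta>(1) z] z' by (simp add: S\<theta>(2) Fob_pr_CBC)
    then show "eelt (Fob (amap (Cmp CatBaseComp (Sum2_CBC X P S \<eta>) (Sum2_CBC X R P \<theta>))) z)
        = eelt (Fob (amap (Sum2_CBC X R S (Cmp (fCat_CBC X) \<eta> \<theta>))) z)"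
      using Fob_Hom[OF S\<theta>(1) z] Fob_Cmp[OF S\<theta>(1) z] Obj_ElD[OF z'] z'
      by (simp add: Sum_CBC_simps S\<eta>(3) S\<theta>(3) S\<eta>\<theta>(3) comp)
  qed
qed

lemma Sum2_CBC_Sig:
  assumes F: "F \<in> Hom CatBaseComp Y X" and \<eta>: "\<eta> \<in> Hom (fCat_CBC X) P S"
  shows "Cmp CatBaseComp (Sum2_CBC X P S \<eta>) (Sig_CBC P F) =
    Cmp CatBaseComp (Sig_CBC S F)
      (Sum2_CBC Y (fcomp_CBC P F) (fcomp_CBC S F) (whisker_CBC \<eta> F))"
proof -
  have P: "P \<in> Obj (fCat_CBC X)" and S: "S \<in> Obj (fCat_CBC X)" using \<eta> by (auto elim: Hom_fCatE)
  have X: "X \<in> Obj CatBaseComp" and Y: "Y \<in> Obj CatBaseComp" using CBC.Hom_Obj[OF F] by auto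
  note S\<eta> = Sum2_CBC[OF X \<eta>]
  note PF = CBC.fcomp_fHom[OF F P] and SF = CBC.fcomp_fHom[OF F S]
  note SgP = Sig_CBC[OF F P] and SgS = Sig_CBC[OF F S]
    and SwF = Sum2_CBC[OF Y CBC.whisker_Hom[OF F \<eta>]]
  interpret based_presheaf "fst Y" "fcomp_CBC P F" "snd Y" using Y PF by (rule presheaf_fCat)
  have f: "asrc F = Y" using F by (auto elim: Hom_CatBaseCompE)
  show ?thesis
  proof (rule Sum_CBC_eqI[OF X S CBC.Cmp_Hom[OF SgP(1) S\<eta>(1)] CBC.Cmp_Hom[OF SwF(1) SgS(1)]])
    show "Cmp CatBaseComp (pr_CBC X S) (Cmp CatBaseComp (Sum2_CBC X P S \<eta>) (Sig_CBC P F))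
        = Cmp CatBaseComp (pr_CBC X S) (Cmp CatBaseComp (Sig_CBC S F)
            (Sum2_CBC Y (fcomp_CBC P F) (fcomp_CBC S F) (whisker_CBC \<eta> F)))"
      using CBC.Cmp_assoc[OF SgP(1) S\<eta>(1) pr_CBC_Hom[OF X S]]
        CBC.Cmp_assoc[OF SwF(1) SgS(1) pr_CBC_Hom[OF X S]]
        CBC.Cmp_assoc[OF SwF(1) pr_CBC_Hom[OF Y SF] F]
      by (simp add: S\<eta>(2) SgP(2) SgS(2) SwF(2))
    fix z assume z: "z \<in> Obj (fst (Sum_CBC Y (fcomp_CBC P F)))"
    then have z': "z \<in> Obj El" by (simp add: Sum_CBC_simps)
    have "eobj (Fob (amap (Sig_CBC P F)) z) = Fob (amap F) (eobj z)"
      using eobj_Fob[OF X P SgP(1) z] Fob_Cmp[OF pr_CBC_Hom[OF Y PF] z] z'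
      by (simp add: SgP(2) Fob_pr_CBC)
    then have "component \<eta> (eobj (Fob (amap (Sig_CBC P F)) z)) (eelt z)
        = component (whisker_CBC \<eta> F) (eobj z) (eelt z)"
      using Obj_ElD[OF z'] by (simp add: whisker_CBC_def f compose_def)
    then show "eelt (Fob (amap (Cmp CatBaseComp (Sum2_CBC X P S \<eta>) (Sig_CBC P F))) z)
        = eelt (Fob (amap (Cmp CatBaseComp (Sig_CBC S F)
            (Sum2_CBC Y (fcomp_CBC P F) (fcomp_CBC S F) (whisker_CBC \<eta> F)))) z)"
      using Fob_Hom[OF SgP(1) z] Fob_Cmp[OF SgP(1) z] Fob_Hom[OF SwF(1) z] Fob_Cmp[OF SwF(1) z] z'
      by (simp add: Sum_CBC_simps S\<eta>(3) SgP(3) SgS(3) SwF(3))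
  qed
qed

theorem proposition7p5:
  "two_fam_Sigma_category
     (CatBaseComp :: ('v catbase, 'v transfer) cat)
     fCat_CBC fcomp_CBC whisker_CBC Sum_CBC pr_CBC Sig_CBC Sum2_CBC"
  by (rule two_fam_Sigma_category.intro[OF CBC.two_fam_category_axioms
        CBC.fam_Sigma_category_axioms two_fam_Sigma_category_axioms.intro])
    (rule Sum2_CBC Sum2_CBC_Sig Sum2_CBC_Idn Sum2_CBC_Cmp; assumption)+

end
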